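(* Let $n \ge 2$ be an integer and let $q = 2^{2^n}$. Then there exists a word $w$ in the free group $F_2$ of rank two such that $\mathrm{SL}_2(q)_w$ contains the identity and four conjugacy classes of elements of order $17$, and contains no other conjugacy class consisting of elements of order $17$.
   Context: A word is an element of a free group. For a group $G$ and a word $w$ in the free group of rank $k$, $G_w := \{ w(g_1,\dots,g_k)^{\pm 1} \mid g_i \in G\}$ denotes the set of word values, where $w(g_1,\dots,g_k)$ is obtained by substituting $g_1,\dots,g_k$ for the free generators. $\mathrm{SL}_2(q)$ is the group of $2\times 2$ matrices of determinant $1$ over the finite field $\mathbb{F}_q$. *)

theory Defs
  imports
    "HOL-Analysis.Determinants"
    "HOL-Algebra.Multiplicative_Group"
    "HOL-Algebra.Group_Action"
begin

section \<open>Free groups of finite rank and words\<close>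

text \<open>
  The free group of rank \<open>k\<close>, on the generators \<open>x\<^sub>0, \<dots>, x\<^sub>k\<^sub>-\<^sub>1\<close>, is realised on freely reduced
  lists of letters. The letter \<open>(i, True)\<close> stands for \<open>x\<^sub>i\<close> and \<open>(i, False)\<close> for its inverse.
\<close>

type_synonym letter = "nat \<times> bool"

definition inv_letter :: "letter \<Rightarrow> letter" where
  "inv_letter a = (fst a, \<not> snd a)"

definition reduced :: "letter list \<Rightarrow> bool" where
  "reduced = successively (\<lambda>a b. b \<noteq> inv_letter a)"

fun cons_letter :: "letter \<Rightarrow> letter list \<Rightarrow> letter list" where
  "cons_letter a [] = [a]"
| "cons_letter a (b # w) = (if b = inv_letter a then w else a # b # w)"

definition reduce :: "letter list \<Rightarrow> letter list" where
  "reduce w = foldr cons_letter w []"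

definition free_group :: "nat \<Rightarrow> letter list monoid" where
  "free_group k = \<lparr>carrier = {w. fst ` set w \<subseteq> {..<k} \<and> reduced w},
                   monoid.mult = (\<lambda>u v. reduce (u @ v)),
                   one = []\<rparr>"

definition eval_letter :: "('a, 'm) monoid_scheme \<Rightarrow> (nat \<Rightarrow> 'a) \<Rightarrow> letter \<Rightarrow> 'a" where
  "eval_letter G g a = (if snd a then g (fst a) else inv\<^bsub>G\<^esub> g (fst a))"

definition eval_word :: "('a, 'm) monoid_scheme \<Rightarrow> (nat \<Rightarrow> 'a) \<Rightarrow> letter list \<Rightarrow> 'a" where
  "eval_word G g w = foldr (\<lambda>a y. eval_letter G g a \<otimes>\<^bsub>G\<^esub> y) w \<one>\<^bsub>G\<^esub>"

text \<open>The set \<open>G\<^sub>w\<close> of values of a word \<open>w\<close> of rank \<open>k\<close>, closed under inversion by definition.\<close>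

definition word_values :: "('a, 'm) monoid_scheme \<Rightarrow> nat \<Rightarrow> letter list \<Rightarrow> 'a set" where
  "word_values G k w =
     (\<Union>g \<in> {..<k} \<rightarrow> carrier G. {eval_word G g w, inv\<^bsub>G\<^esub> eval_word G g w})"

lemma inv_letter_inv_letter [simp]: "inv_letter (inv_letter a) = a"
  by (simp add: inv_letter_def)

lemma fst_inv_letter [simp]: "fst (inv_letter a) = fst a"
  by (simp add: inv_letter_def)

lemma reduced_Nil [simp]: "reduced []"
  by (simp add: reduced_def)

lemma reduced_Cons:
  "reduced (a # w) \<longleftrightarrow> reduced w \<and> (case w of [] \<Rightarrow> True | b # _ \<Rightarrow> b \<noteq> inv_letter a)"
  by (cases w) (auto simp: reduced_def)

lemma reduced_cons_letter: "reduced w \<Longrightarrow> reduced (cons_letter a w)"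
  by (cases w) (auto simp: reduced_Cons)

lemma set_cons_letter: "set (cons_letter a w) \<subseteq> insert a (set w)"
  by (cases w) auto

lemma cons_letter_inverse:
  assumes "reduced w"
  shows "cons_letter a (cons_letter (inv_letter a) w) = w"
proof (cases w)
  case (Cons b v)
  show ?thesis
  proof (cases "b = a")
    case True
    with assms Cons show ?thesis by (cases v) (simp_all add: reduced_Cons)
  qed (simp add: Cons)
qed simp

lemma reduced_foldr: "reduced v \<Longrightarrow> reduced (foldr cons_letter u v)"
  by (induction u) (auto intro: reduced_cons_letter)

lemma reduced_reduce: "reduced (reduce w)"
  by (simp add: reduce_def reduced_foldr)

lemma set_reduce: "set (reduce w) \<subseteq> set w"
  unfolding reduce_def
proof (induction w)
  case (Cons a w)
  then show ?case using set_cons_letter[of a "foldr cons_letter w []"] by auto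
qed simp

lemma reduce_reduced: "reduced w \<Longrightarrow> reduce w = w"
proof (induction w)
  case (Cons a w)
  then show ?case by (cases w) (auto simp: reduce_def reduced_Cons)
qed (simp add: reduce_def)

lemma foldr_cons_letter:
  assumes "reduced v"
  shows "foldr cons_letter (cons_letter a u) v = cons_letter a (foldr cons_letter u v)"
proof (cases u)
  case (Cons b u')
  have "cons_letter a (cons_letter (inv_letter a) (foldr cons_letter u' v)) = foldr cons_letter u' v"
    by (rule cons_letter_inverse[OF reduced_foldr[OF assms]])
  then show ?thesis using Cons by auto
qed simp

lemma foldr_reduce:
  assumes "reduced v"
  shows "foldr cons_letter (reduce u) v = foldr cons_letter u v"
  by (induction u) (simp_all add: reduce_def foldr_cons_letter[OF assms])

lemma reduce_append: "reduce (u @ v) = foldr cons_letter u (reduce v)"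
  by (simp add: reduce_def)

lemma reduce_append_reduce: "reduce (reduce u @ v) = reduce (u @ v)" "reduce (u @ reduce v) = reduce (u @ v)"
  by (simp_all add: reduce_append foldr_reduce reduced_reduce reduce_reduced)

lemma reduce_inverse: "reduce (map inv_letter (rev w) @ w) = []"
proof (induction w)
  case (Cons a w)
  have "cons_letter (inv_letter a) (cons_letter a (reduce w)) = reduce w"
    using cons_letter_inverse[OF reduced_reduce, of "inv_letter a"] by simp
  then show ?case using Cons by (simp add: reduce_append) (simp add: reduce_def)
qed (simp add: reduce_def)

lemma group_free_group: "group (free_group k)"
proof (rule groupI)
  fix u v assume uv: "u \<in> carrier (free_group k)" "v \<in> carrier (free_group k)"
  have "fst ` set (reduce (u @ v)) \<subseteq> fst ` set (u @ v)"
    by (rule image_mono) (rule set_reduce)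
  also have "\<dots> \<subseteq> {..<k}" using uv by (auto simp: free_group_def)
  finally show "u \<otimes>\<^bsub>free_group k\<^esub> v \<in> carrier (free_group k)"
    by (simp add: free_group_def reduced_reduce)
next
  fix u v w
  show "u \<otimes>\<^bsub>free_group k\<^esub> v \<otimes>\<^bsub>free_group k\<^esub> w = u \<otimes>\<^bsub>free_group k\<^esub> (v \<otimes>\<^bsub>free_group k\<^esub> w)"
    by (simp add: free_group_def reduce_append_reduce)
next
  fix w assume w: "w \<in> carrier (free_group k)"
  let ?w' = "reduce (map inv_letter (rev w))"
  have "fst ` set ?w' \<subseteq> fst ` set (map inv_letter (rev w))"
    by (rule image_mono) (rule set_reduce)
  also have "\<dots> = fst ` set w" by (simp add: image_image)
  also have "\<dots> \<subseteq> {..<k}" using w by (simp add: free_group_def)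
  finally have "?w' \<in> carrier (free_group k)" by (simp add: free_group_def reduced_reduce)
  moreover have "?w' \<otimes>\<^bsub>free_group k\<^esub> w = \<one>\<^bsub>free_group k\<^esub>"
    by (simp add: free_group_def reduce_append_reduce reduce_inverse)
  ultimately show "\<exists>v\<in>carrier (free_group k). v \<otimes>\<^bsub>free_group k\<^esub> w = \<one>\<^bsub>free_group k\<^esub>" by blast
qed (auto simp: free_group_def reduce_reduced)

context group
begin

lemma eval_letter_closed:
  "g \<in> {..<k} \<rightarrow> carrier G \<Longrightarrow> fst a < k \<Longrightarrow> eval_letter G g a \<in> carrier G"
  by (auto simp: eval_letter_def)

lemma eval_word_closed:
  "g \<in> {..<k} \<rightarrow> carrier G \<Longrightarrow> fst ` set w \<subseteq> {..<k} \<Longrightarrow> eval_word G g w \<in> carrier G"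
  by (induction w) (auto simp: eval_word_def intro!: eval_letter_closed)

lemma eval_word_append:
  assumes "g \<in> {..<k} \<rightarrow> carrier G" "fst ` set u \<subseteq> {..<k}" "fst ` set v \<subseteq> {..<k}"
  shows "eval_word G g (u @ v) = eval_word G g u \<otimes> eval_word G g v"
  using assms(2)
proof (induction u)
  case Nil
  then show ?case using eval_word_closed[OF assms(1,3)] by (simp add: eval_word_def)
next
  case (Cons a u)
  then have "eval_letter G g a \<in> carrier G" "eval_word G g u \<in> carrier G"
    using eval_letter_closed[OF assms(1)] eval_word_closed[OF assms(1)] by auto
  then show ?case using Cons eval_word_closed[OF assms(1,3)]
    by (simp add: eval_word_def m_assoc)
qed

lemma eval_word_cons_letter:
  assumes g: "g \<in> {..<k} \<rightarrow> carrier G" and a: "fst a < k" and w: "fst ` set w \<subseteq> {..<k}"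
  shows "eval_word G g (cons_letter a w) = eval_letter G g a \<otimes> eval_word G g w"
proof (cases w)
  case Nil
  then show ?thesis by (simp add: eval_word_def)
next
  case (Cons b v)
  show ?thesis
  proof (cases "b = inv_letter a")
    case True
    have ga: "g (fst a) \<in> carrier G" using g a by auto
    have v: "eval_word G g v \<in> carrier G" using eval_word_closed[OF g] w Cons by simp
    have "eval_letter G g a \<otimes> eval_letter G g b = \<one>"
      using ga True by (auto simp: eval_letter_def inv_letter_def)
    moreover have "eval_letter G g a \<in> carrier G" "eval_letter G g b \<in> carrier G"
      using ga True by (auto simp: eval_letter_def inv_letter_def)
    ultimately show ?thesis using Cons True v
      by (simp add: eval_word_def flip: m_assoc)
  qed (simp add: Cons eval_word_def)
qed

lemma eval_word_reduce:
  assumes g: "g \<in> {..<k} \<rightarrow> carrier G" and "fst ` set w \<subseteq> {..<k}"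
  shows "eval_word G g (reduce w) = eval_word G g w"
  using assms(2)
proof (induction w)
  case (Cons a w)
  have "fst ` set (reduce w) \<subseteq> {..<k}" using Cons.prems set_reduce[of w] by auto
  then show ?case
    using Cons eval_word_cons_letter[OF g, of a "reduce w"] by (simp add: reduce_def eval_word_def)
qed (simp add: reduce_def)

lemma eval_word_hom:
  assumes g: "g \<in> {..<k} \<rightarrow> carrier G"
  shows "eval_word G g \<in> hom (free_group k) G"
proof (rule homI)
  fix u v assume uv: "u \<in> carrier (free_group k)" "v \<in> carrier (free_group k)"
  then have "fst ` set u \<subseteq> {..<k}" "fst ` set v \<subseteq> {..<k}" by (auto simp: free_group_def)
  then show "eval_word G g (u \<otimes>\<^bsub>free_group k\<^esub> v) = eval_word G g u \<otimes> eval_word G g v"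
    using eval_word_reduce[OF g, of "u @ v"] eval_word_append[OF g]
    by (simp add: free_group_def image_Un)
qed (use eval_word_closed[OF g] in \<open>auto simp: free_group_def\<close>)

lemma eval_word_generator: "g i \<in> carrier G \<Longrightarrow> eval_word G g [(i, True)] = g i"
  by (simp add: eval_word_def eval_letter_def)

end

section \<open>Conjugacy classes and special linear groups\<close>

definition conjugacy_classes :: "('a, 'm) monoid_scheme \<Rightarrow> 'a set set" where
  "conjugacy_classes G =
     orbits G (carrier G) (\<lambda>g. \<lambda>h\<in>carrier G. g \<otimes>\<^bsub>G\<^esub> h \<otimes>\<^bsub>G\<^esub> inv\<^bsub>G\<^esub> g)"

definition SL :: "('a::field ^ 'n ^ 'n) monoid" where
  "SL = \<lparr>carrier = {A. det A = 1}, monoid.mult = (\<lambda>A B. A ** B), one = mat 1\<rparr>"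

lemma group_SL: "group (SL :: ('a::field ^ 'n ^ 'n) monoid)"
proof (rule groupI)
  fix A :: "'a ^ 'n ^ 'n" assume A: "A \<in> carrier SL"
  then have "invertible A" by (simp add: SL_def invertible_det_nz)
  then obtain B where B: "B ** A = mat 1" by (auto simp: invertible_def)
  then have "det B * det A = 1" by (metis det_mul det_I)
  with A B show "\<exists>B\<in>carrier SL. B \<otimes>\<^bsub>SL\<^esub> A = \<one>\<^bsub>SL\<^esub>" by (auto simp: SL_def)
qed (auto simp: SL_def det_mul matrix_mul_assoc)

end

theory Submission
  imports Defs "HOL-Algebra.SimpleGroups"
begin

text \<open>
  In a field of characteristic two whose order is a power of \<open>16\<close>, an element of order \<open>17\<close>
  of the special linear group of degree two is determined up to conjugacy by its trace, and
  these traces are the roots of the octic \<open>x ^ 8 + x ^ 7 + x ^ 6 + x ^ 4 + 1\<close>, which is the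
  product of the quartics \<open>x ^ 4 + x + 1\<close> and \<open>x ^ 4 + x ^ 3 + x ^ 2 + x + 1\<close>
  (\<open>trace_order_17\<close>, \<open>char2_root_of_pair\<close>). The Frobenius map acts transitively on the four
  roots of each, so the traces of a word, being compatible with it, can only contain all or
  none of the roots of a given quartic. A word is needed that takes one orbit and avoids the
  other.

  Such a word is obtained by an argument of Lubotzky. Let \<open>f\<close> be the evaluation of words at
  a pair of generators of the simple group \<open>G\<close> (\<open>steinberg_generators\<close>, \<open>simple_SL2\<close>). There
  are finitely many kernels of evaluations. Because \<open>G\<close> is simple and not commutative, the
  intersection of all kernels that are not contained in the kernel of \<open>f\<close> is still mapped
  onto \<open>G\<close> by \<open>f\<close> (\<open>avoid_kernels\<close>). Hence there is a word \<open>w\<close> such that \<open>f w\<close> is any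
  prescribed element and every evaluation \<open>h\<close> either is trivial at \<open>w\<close> or has the same
  kernel as \<open>f\<close>, in which case it differs from \<open>f\<close> by an automorphism of \<open>G\<close>.

  It remains to see that automorphisms do not mix the two orbits. Prescribe \<open>f w = X Y\<close> with
  \<open>X\<close> of order \<open>2\<close>, \<open>Y\<close> of order \<open>3\<close> and with a root \<open>t\<close> of the first quartic as trace of
  \<open>X Y\<close>. The commutator of \<open>X\<close> and \<open>Y\<close> then has trace \<open>1 + t ^ 2\<close>, again a root of the first
  quartic, so it has order \<open>17\<close> as well. The orders of \<open>X\<close>, \<open>Y\<close>, \<open>X Y\<close> and of the commutator
  are invariant under automorphisms, but for a root \<open>t\<close> of the second quartic the element
  \<open>1 + t ^ 2\<close> is not the trace of an element of order \<open>17\<close> (\<open>trace_transfer\<close>). Thus all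
  nontrivial values of \<open>w\<close> have roots of the first quartic as traces. Conversely, the set of
  values is invariant under conjugation and under the Frobenius map, so every element with
  such a trace is a value.
\<close>

section \<open>Fields of characteristic two\<close>

lemma char2_numeral:
  assumes "(2::'a::comm_ring_1) = 0"
  shows "numeral (num.Bit0 k) = (0::'a)" "numeral (num.Bit1 k) = (1::'a)"
proof -
  have *: "numeral (num.Bit0 k) = (2::'a) * numeral k"
    by (metis mult_2 numeral_Bit0)
  show "numeral (num.Bit0 k) = (0::'a)" unfolding * assms by simp
  then show "numeral (num.Bit1 k) = (1::'a)" unfolding numeral_Bit0 numeral_Bit1 by simp
qed

lemma char2_uminus: "(2::'a::comm_ring_1) = 0 \<Longrightarrow> - x = (x::'a)"
  by (metis add_eq_0_iff mult_2 mult_zero_left)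

lemma char2_diff: "(2::'a::comm_ring_1) = 0 \<Longrightarrow> x - y = x + (y::'a)"
  by (metis char2_uminus diff_conv_add_uminus)

lemma char2_eq_iff: "(2::'a::comm_ring_1) = 0 \<Longrightarrow> x + y = 0 \<longleftrightarrow> x = (y::'a)"
  by (metis char2_uminus add_eq_0_iff)

lemma char2_square_add: "(2::'a::comm_ring_1) = 0 \<Longrightarrow> (x + y)\<^sup>2 = x\<^sup>2 + (y::'a)\<^sup>2"
  by (simp add: power2_sum)

lemma char2_square_inj:
  fixes x y :: "'a::idom"
  assumes "(2::'a) = 0" "x\<^sup>2 = y\<^sup>2"
  shows "x = y"
  using assms by (metis char2_uminus power2_eq_iff)

text \<open>
  Squaring is injective, hence surjective by finiteness.
\<close>
lemma char2_square_surj: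
  assumes "(2::'a::{field,finite}) = 0"
  obtains s where "s\<^sup>2 = (r::'a)"
proof -
  have "inj (\<lambda>x::'a. x\<^sup>2)"
  proof (rule injI)
    fix x y :: 'a assume "x\<^sup>2 = y\<^sup>2"
    then show "x = y" by (rule char2_square_inj[OF assms])
  qed
  then have "surj (\<lambda>x::'a. x\<^sup>2)" by (metis finite_UNIV_inj_surj finite)
  then show ?thesis by (metis that surjD)
qed

text \<open>
  Translation by \<open>1\<close> permutes the field, so summing all elements shows that the number of
  elements vanishes in the field.
\<close>
lemma two_eq_zero_if_card_power_of_two:
  assumes "CARD('a::{field,finite}) = 2 ^ k"
  shows "(2::'a) = 0"
proof -
  have "(\<Sum>x\<in>(UNIV::'a set). x + 1) = (\<Sum>x\<in>UNIV. x)"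
    by (rule sum.reindex_bij_witness[of _ "\<lambda>x. x - 1" "\<lambda>x. x + 1"]) auto
  then have "of_nat (CARD('a)) = (0::'a)" by (simp add: sum.distrib)
  then show ?thesis by (simp add: assms)
qed

text \<open>
  The field as a record, so that the cyclicity of the multiplicative group, known for
  locale-based fields, can be transferred to the type class.
\<close>
definition type_ring :: "'a::field ring" where
  "type_ring = \<lparr>carrier = UNIV, monoid.mult = (*), one = 1, ring.zero = 0, add = (+)\<rparr>"

lemma field_type_ring: "Ring.field (type_ring :: 'a::field ring)"
proof -
  have "\<exists>y. y + x = 0 \<and> x + y = 0" for x :: 'a
    by (rule exI[of _ "- x"]) simp
  then have "cring (type_ring :: 'a ring)"
    by (intro cringI abelian_groupI comm_monoidI) (auto simp: type_ring_def algebra_simps)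
  then show ?thesis
  proof (rule cring.cring_fieldI2)
    fix x :: 'a assume "x \<in> carrier type_ring" "x \<noteq> \<zero>\<^bsub>type_ring\<^esub>"
    then show "\<exists>y\<in>carrier type_ring. x \<otimes>\<^bsub>type_ring\<^esub> y = \<one>\<^bsub>type_ring\<^esub>"
      by (intro bexI[of _ "inverse x"]) (simp_all add: type_ring_def)
  qed (simp add: type_ring_def)
qed

lemma finite_field_primitive_element:
  obtains l :: "'a::{field,finite}" where "l \<noteq> 0" "\<And>x. x \<noteq> 0 \<Longrightarrow> \<exists>i::nat. x = l ^ i"
proof -
  let ?R = "type_ring :: 'a ring"
  interpret R: field ?R by (rule field_type_ring)
  have pow: "a [^]\<^bsub>?R\<^esub> i = a ^ i" for a and i :: nat
    by (induction i) (simp_all add: type_ring_def)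
  have fin: "finite (carrier ?R)" by (rule finite)
  from R.finite_field_mult_group_has_gen[OF fin] obtain l where
    l: "l \<in> carrier (mult_of ?R)" "carrier (mult_of ?R) = {l [^]\<^bsub>?R\<^esub> i | i::nat. i \<in> UNIV}" by blast
  have "carrier (mult_of ?R) = UNIV - {0}" by (simp add: type_ring_def)
  with l show ?thesis by (intro that[of l]) (auto simp: pow)
qed

section \<open>The quartic whose roots are the traces\<close>

text \<open>
  The cardinality is a power of \<open>16\<close>. The divisibility provides an element of order \<open>15\<close>,
  which generates the subfield of \<open>16\<close> elements.
\<close>
lemma card_tower_facts:
  assumes "CARD('a::{field,finite}) = 2 ^ (2 ^ n)" "n \<ge> 2"
  shows "15 dvd CARD('a) - 1" "CARD('a) \<ge> 16"
proof -
  define m :: nat where "m = 2 ^ (n - 2)"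
  have "(2::nat) ^ n = 2 ^ 2 * 2 ^ (n - 2)"
    using assms(2) by (metis le_add_diff_inverse power_add)
  then have "(2::nat) ^ n = 4 * m" unfolding m_def by simp
  then have q: "CARD('a) = 16 ^ m" by (simp add: assms(1) power_mult)
  have "(16::nat) ^ m mod 15 = 1" by (simp add: power_mod[of 16 15 m, symmetric])
  then show "15 dvd CARD('a) - 1" unfolding q by (metis dvd_minus_mod)
  have "m > 0" by (simp add: m_def)
  then show "CARD('a) \<ge> 16" unfolding q by (simp add: self_le_power)
qed

text \<open>
  Over the field of two elements the cyclotomic polynomial of order \<open>15\<close> is the product of
  \<open>x ^ 4 + x + 1\<close> and its reversal \<open>x ^ 4 + x ^ 3 + 1\<close>. Its integral form appears below as
  the cofactor of \<open>(x ^ 5 - 1) * (x ^ 2 + x + 1)\<close> in \<open>x ^ 15 - 1\<close>.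
\<close>
lemma char2_order_15_roots:
  fixes z :: "'a::idom"
  assumes two: "(2::'a) = 0" and z: "z ^ 15 = 1" "z ^ 3 \<noteq> 1" "z ^ 5 \<noteq> 1"
  shows "z ^ 4 + z + 1 = 0 \<or> z ^ 4 + z ^ 3 + 1 = 0"
proof -
  let ?c = "z ^ 8 - z ^ 7 + z ^ 5 - z ^ 4 + z ^ 3 - z + 1"
  have "(z - 1) * (z\<^sup>2 + z + 1) = z ^ 3 - 1" by Groebner_Basis.algebra
  then have "z\<^sup>2 + z + 1 \<noteq> 0" using z(2) by (metis eq_iff_diff_eq_0 mult_zero_right)
  moreover have "(z ^ 5 - 1) * ((z\<^sup>2 + z + 1) * ?c) = z ^ 15 - 1" by Groebner_Basis.algebra
  then have "(z ^ 5 - 1) * ((z\<^sup>2 + z + 1) * ?c) = 0" by (simp only: z(1) diff_self)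
  ultimately have "?c = 0" using z(3) by (metis eq_iff_diff_eq_0 mult_eq_0_iff)
  moreover have "(z ^ 4 + z + 1) * (z ^ 4 + z ^ 3 + 1) = ?c + 2 * (z ^ 7 + 2 * z ^ 4 + z)"
    by Groebner_Basis.algebra
  ultimately have "(z ^ 4 + z + 1) * (z ^ 4 + z ^ 3 + 1) = 0" by (simp only: two mult_zero_left add_0_left)
  then show ?thesis by (rule mult_eq_0_iff[THEN iffD1])
qed

text \<open>
  A suitable power \<open>z\<close> of a primitive element has order \<open>15\<close>. It is a root of the quartic or
  of its reversal, and in the latter case \<open>1 / z\<close> is a root of the quartic.
\<close>
lemma quartic_has_root:
  assumes card: "CARD('a::{field,finite}) = 2 ^ (2 ^ n)" and n: "n \<ge> 2"
  shows "\<exists>t::'a. t ^ 4 + t + 1 = 0"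
proof -
  have two: "(2::'a) = 0" by (rule two_eq_zero_if_card_power_of_two[OF card])
  obtain l :: 'a where l: "l \<noteq> 0" and gen: "\<And>x. x \<noteq> 0 \<Longrightarrow> \<exists>i::nat. x = l ^ i"
    by (rule finite_field_primitive_element) blast
  define q where "q = CARD('a)"
  obtain d where d: "q - 1 = 15 * d" using card_tower_facts[OF card n] by (auto simp: q_def)
  have "q \<ge> 16" using card_tower_facts[OF card n] by (simp add: q_def)
  then have d0: "d > 0" using d by (cases d) auto
  \<comment> \<open>the powers of \<open>l\<close> exhaust the nonzero elements, so the order of \<open>l\<close> cannot be smaller than \<open>q - 1\<close>\<close>
  have nt: "l ^ k \<noteq> 1" if "0 < k" "k < q - 1" for k
  proof
    assume k: "l ^ k = 1"
    have "UNIV - {0} \<subseteq> (\<lambda>i. l ^ i) ` {..<k}"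
    proof
      fix x :: 'a assume "x \<in> UNIV - {0}"
      then obtain i where "x = l ^ i" using gen by auto
      also have "\<dots> = l ^ (k * (i div k) + i mod k)" by simp
      also have "\<dots> = l ^ (i mod k)" by (simp only: power_add power_mult k) simp
      finally show "x \<in> (\<lambda>i. l ^ i) ` {..<k}" using that by auto
    qed
    then have "card (UNIV - {0::'a}) \<le> k"
      by (metis card_lessThan finite_lessThan surj_card_le)
    then show False using that by (simp add: q_def card_Diff_singleton)
  qed
  define z where "z = l ^ d"
  have l1: "l ^ (q - 1) = 1"
  proof -
    have "(\<Prod>y\<in>UNIV - {0}. l * y) = (\<Prod>y\<in>UNIV - {0}. y)"
      by (rule prod.reindex_bij_witness[of _ "\<lambda>y. y / l" "\<lambda>y. l * y"]) (use l in auto)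
    then show ?thesis by (simp add: prod.distrib q_def card_Diff_singleton)
  qed
  have z15: "z ^ 15 = 1" using l1 d by (simp add: z_def mult.commute flip: power_mult)
  have "z ^ 3 \<noteq> 1" "z ^ 5 \<noteq> 1"
    unfolding z_def using nt[of "d * 3"] nt[of "d * 5"] d d0 by (simp_all flip: power_mult)
  have "z ^ 4 + z + 1 = 0 \<or> z ^ 4 + z ^ 3 + 1 = 0"
    by (rule char2_order_15_roots) fact+
  moreover have "inverse z ^ 4 + inverse z + 1 = 0" if "z ^ 4 + z ^ 3 + 1 = 0"
  proof -
    have "z \<noteq> 0" using l by (simp add: z_def)
    then have "inverse z ^ 4 + inverse z + 1 = (z ^ 4 + z ^ 3 + 1) / z ^ 4"
      by (simp add: field_simps eval_nat_numeral)
    then show ?thesis by (simp add: that)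
  qed
  ultimately show ?thesis by blast
qed

text \<open>
  The first two values are the coefficients that express the seventeenth power of a matrix
  of trace \<open>t\<close> in terms of that matrix and the identity; a root of the quartic makes this
  power trivial.
\<close>
lemma char2_quartic_root_facts:
  fixes t :: "'a::idom"
  assumes two: "(2::'a) = 0" and t: "t ^ 4 + t + 1 = 0"
  shows "t ^ 16 + t ^ 14 + t ^ 12 + t ^ 8 + 1 = 0" "t ^ 15 = 1" "t \<noteq> 0" "t \<noteq> 1"
proof -
  show nz: "t \<noteq> 0" using t by auto
  show "t \<noteq> 1" using t by (auto simp: char2_numeral[OF two])
  have "t ^ 4 + (t + 1) = 0" using t by (simp add: add.assoc)
  then have t4: "t ^ 4 = t + 1" by (simp only: char2_eq_iff[OF two])
  have "t ^ 8 = (t ^ 4)\<^sup>2" by simp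
  then have t8: "t ^ 8 = t\<^sup>2 + 1" by (simp add: t4 char2_square_add[OF two])
  have "t ^ 16 = (t ^ 8)\<^sup>2" by simp
  also have "\<dots> = t ^ 4 + 1" by (simp add: t8 char2_square_add[OF two])
  also have "\<dots> = t" by (simp add: t4 char2_numeral[OF two])
  finally have t16: "t ^ 16 = t" .
  then have "t * t ^ 15 = t * 1" by (simp flip: power_Suc)
  then show "t ^ 15 = 1" using nz by (simp only: mult_cancel_left) simp
  have "t ^ 14 = t ^ 8 * t ^ 4 * t\<^sup>2" "t ^ 12 = t ^ 8 * t ^ 4" by (simp_all flip: power_add)
  then have "t ^ 16 + t ^ 14 + t ^ 12 + t ^ 8 + 1 =
     t + (t\<^sup>2 + 1) * (t + 1) * t\<^sup>2 + (t\<^sup>2 + 1) * (t + 1) + (t\<^sup>2 + 1) + 1" by (simp only: t16 t8 t4)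
  also have "\<dots> = t * (t ^ 4 + t + 1) + (t ^ 4 + t + 1) + 2 * (t ^ 3 + t\<^sup>2 + 1)" by Groebner_Basis.algebra
  finally show "t ^ 16 + t ^ 14 + t ^ 12 + t ^ 8 + 1 = 0" by (simp only: t two) simp
qed

text \<open>
  The Frobenius map permutes the roots:
  \<open>t \<mapsto> t ^ 2 \<mapsto> t + 1 \<mapsto> t ^ 2 + 1 \<mapsto> t\<close>. There are no others
  because the quartic is \<open>1\<close> plus an additive polynomial, so that the difference \<open>d\<close> of two
  roots satisfies \<open>d ^ 4 + d = 0\<close>, and the factor \<open>d ^ 2 + d + 1\<close> of \<open>d ^ 4 + d\<close> has the
  roots \<open>t ^ 2 + t\<close> and \<open>t ^ 2 + t + 1\<close>.
\<close>
lemma char2_quartic_roots: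
  fixes t :: "'a::idom"
  assumes two: "(2::'a) = 0" and t: "t ^ 4 + t + 1 = 0"
  shows "{s. s ^ 4 + s + 1 = 0} = {t, t\<^sup>2, t + 1, t\<^sup>2 + 1}" (is ?A)
    "card {s::'a. s ^ 4 + s + 1 = 0} = 4"
proof -
  have t4: "t ^ 4 + t = 1" using t by (simp only: char2_eq_iff[OF two])
  have t4': "t ^ 4 = t + 1" using t4 by (metis add.commute char2_eq_iff[OF two] add.assoc add_cancel_right_left)
  have pow4: "(x + y) ^ 4 = x ^ 4 + y ^ 4" for x y :: 'a
  proof -
    have "(x + y) ^ 4 = ((x + y)\<^sup>2)\<^sup>2" by simp
    then show ?thesis by (simp add: char2_square_add[OF two])
  qed
  have sq: "(t\<^sup>2) ^ 4 + t\<^sup>2 + 1 = 0"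
  proof -
    have "(t ^ 4 + t + 1)\<^sup>2 = (t\<^sup>2) ^ 4 + t\<^sup>2 + 1"
      by (simp add: char2_square_add[OF two] flip: power_mult)
    then show ?thesis by (simp add: t)
  qed
  have shift: "(s + 1) ^ 4 + (s + 1) + 1 = s ^ 4 + s + 1" for s :: 'a
    by (simp add: pow4 algebra_simps char2_numeral[OF two])
  have "s \<in> {t, t\<^sup>2, t + 1, t\<^sup>2 + 1}" if s: "s ^ 4 + s + 1 = 0" for s
  proof -
    define d where "d = s + t"
    define e where "e = t\<^sup>2 + t"
    have "s ^ 4 + s = 1" using s by (simp only: char2_eq_iff[OF two])
    have "e\<^sup>2 + e = t ^ 4 + t + 2 * t\<^sup>2" unfolding e_def char2_square_add[OF two] by simp
    then have e: "e\<^sup>2 + e = 1" by (simp add: t4 two)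
    have "d ^ 4 + d = (s ^ 4 + s) + (t ^ 4 + t)" unfolding d_def pow4 by (simp add: algebra_simps)
    also have "\<dots> = 0" using \<open>s ^ 4 + s = 1\<close> t4 by (simp add: two)
    finally have d: "d ^ 4 + d = 0" .
    have "(d + e) * (d + e + 1) = d\<^sup>2 + d + (e\<^sup>2 + e) + 2 * (d * e)" by Groebner_Basis.algebra
    then have "d * (d + 1) * ((d + e) * (d + e + 1)) = d * (d + 1) * (d\<^sup>2 + d + 1)"
      by (simp add: e two)
    also have "\<dots> = d ^ 4 + d + 2 * (d ^ 3 + d\<^sup>2)" by Groebner_Basis.algebra
    finally have "d * (d + 1) * ((d + e) * (d + e + 1)) = 0" by (simp only: d two) simp
    then have "d = 0 \<or> d + 1 = 0 \<or> d + e = 0 \<or> d + e + 1 = 0"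
      by (simp only: mult_eq_0_iff disj_assoc)
    then have "s + t = 0 \<or> s + (t + 1) = 0 \<or> s + t\<^sup>2 + 2 * t = 0 \<or> s + (t\<^sup>2 + 1) + 2 * t = 0"
      unfolding d_def e_def by (simp add: algebra_simps)
    then show ?thesis by (auto simp: char2_eq_iff[OF two] two)
  qed
  moreover have "s ^ 4 + s + 1 = 0" if "s \<in> {t, t\<^sup>2, t + 1, t\<^sup>2 + 1}" for s
    using that t sq shift[of t] shift[of "t\<^sup>2"] by (elim insertE) (simp_all only: empty_iff)
  ultimately show *: ?A by blast
  have "t\<^sup>2 \<noteq> t" using char2_quartic_root_facts(3,4)[OF two t] by (auto simp: power2_eq_square)
  moreover have "t\<^sup>2 \<noteq> t + 1"
  proof
    assume h: "t\<^sup>2 = t + 1"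
    have "t ^ 4 = (t\<^sup>2)\<^sup>2" by simp
    also have "\<dots> = t" by (simp add: h char2_square_add[OF two] char2_numeral[OF two])
    finally show False using t4' by simp
  qed
  moreover from this have "t \<noteq> t\<^sup>2 + 1" by (metis char2_numeral(1)[OF two] add.assoc add_0_right one_add_one)
  ultimately show "card {s::'a. s ^ 4 + s + 1 = 0} = 4" unfolding * by auto
qed

lemma char2_quartic_roots_subset:
  fixes t :: "'a::idom"
  assumes two: "(2::'a) = 0" and t: "t ^ 4 + t + 1 = 0" "t \<in> T"
    and square: "\<And>s. s \<in> T \<Longrightarrow> s\<^sup>2 \<in> T"
  shows "{s. s ^ 4 + s + 1 = 0} \<subseteq> T"
proof -
  have "(t\<^sup>2)\<^sup>2 + (t + 1) = t ^ 4 + t + 1" by (simp add: add.assoc)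
  then have "(t\<^sup>2)\<^sup>2 + (t + 1) = 0" unfolding t(1) .
  then have t4: "(t\<^sup>2)\<^sup>2 = t + 1" by (rule char2_eq_iff[OF two, THEN iffD1])
  have t8: "(t + 1)\<^sup>2 = t\<^sup>2 + 1" unfolding char2_square_add[OF two] by simp
  have 1: "t\<^sup>2 \<in> T" by (rule square[OF t(2)])
  have 2: "t + 1 \<in> T" using square[OF 1] unfolding t4 .
  have 3: "t\<^sup>2 + 1 \<in> T" using square[OF 2] unfolding t8 .
  show ?thesis unfolding char2_quartic_roots(1)[OF two t(1)] insert_subset
    by (intro conjI t(2) 1 2 3 empty_subsetI)
qed

text \<open>
  The octic \<open>x ^ 8 + x ^ 7 + x ^ 6 + x ^ 4 + 1\<close>, whose roots are the traces of elements of
  order \<open>17\<close>, factors over the field of two elements as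
  \<open>(x ^ 4 + x + 1) * (x ^ 4 + x ^ 3 + x ^ 2 + x + 1)\<close>. The first factor is invariant under
  \<open>x \<mapsto> x + 1\<close>, whereas no root of the second is mapped to a root of the octic. The
  substitution \<open>t \<mapsto> 1 + t ^ 2\<close>, which is the effect of passing from a product to a
  commutator, therefore tells the two factors apart.
\<close>
lemma char2_root_of_pair:
  fixes t :: "'a::idom"
  assumes two: "(2::'a) = 0"
    and t: "t ^ 8 + t ^ 7 + t ^ 6 + t ^ 4 + 1 = 0"
    and t': "(1 + t\<^sup>2) ^ 8 + (1 + t\<^sup>2) ^ 7 + (1 + t\<^sup>2) ^ 6 + (1 + t\<^sup>2) ^ 4 + 1 = 0"
  shows "t ^ 4 + t + 1 = 0"
proof (rule ccontr)
  assume A: "t ^ 4 + t + 1 \<noteq> 0"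
  have fac: "(s ^ 4 + s + 1) * (s ^ 4 + s ^ 3 + s\<^sup>2 + s + 1) =
      s ^ 8 + s ^ 7 + s ^ 6 + s ^ 4 + 1 + 2 * (s ^ 5 + s ^ 4 + s ^ 3 + s\<^sup>2 + s)" for s :: 'a
    by Groebner_Basis.algebra
  have fac0: "s ^ 4 + s + 1 = 0 \<or> s ^ 4 + s ^ 3 + s\<^sup>2 + s + 1 = 0"
    if "s ^ 8 + s ^ 7 + s ^ 6 + s ^ 4 + 1 = 0" for s :: 'a
    using fac[of s] unfolding that two mult_zero_left add_0_left by (rule mult_eq_0_iff[THEN iffD1])
  have B: "t ^ 4 + t ^ 3 + t\<^sup>2 + t + 1 = 0" using fac0[OF t] A by blast
  \<comment> \<open>the octic at \<open>1 + t\<^sup>2 = (1 + t)\<^sup>2\<close> is the square of the octic at \<open>1 + t\<close>\<close>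
  have sq: "1 + t\<^sup>2 = (1 + t)\<^sup>2" by (simp add: char2_square_add[OF two])
  have "(s ^ 8 + s ^ 7 + s ^ 6 + s ^ 4 + 1)\<^sup>2 =
      (s\<^sup>2) ^ 8 + (s\<^sup>2) ^ 7 + (s\<^sup>2) ^ 6 + (s\<^sup>2) ^ 4 + 1" for s :: 'a
    by (simp add: char2_square_add[OF two] flip: power_mult)
  from this[of "1 + t"] have "((1 + t) ^ 8 + (1 + t) ^ 7 + (1 + t) ^ 6 + (1 + t) ^ 4 + 1)\<^sup>2 = 0"
    by (simp only: t' flip: sq)
  then have "(1 + t) ^ 8 + (1 + t) ^ 7 + (1 + t) ^ 6 + (1 + t) ^ 4 + 1 = 0" by simp
  moreover have "(1 + t) ^ 4 + (1 + t) + 1 = t ^ 4 + t + 1 + 2 * (2 * t ^ 3 + 3 * t\<^sup>2 + 2 * t + 1)"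
    by Groebner_Basis.algebra
  then have "(1 + t) ^ 4 + (1 + t) + 1 \<noteq> 0" using A by (simp only: two mult_zero_left add_0_right) simp
  ultimately have "(1 + t) ^ 4 + (1 + t) ^ 3 + (1 + t)\<^sup>2 + (1 + t) + 1 = 0" using fac0 by blast
  moreover have "(1 + t) ^ 4 + (1 + t) ^ 3 + (1 + t)\<^sup>2 + (1 + t) + 1 =
      (t ^ 4 + t ^ 3 + t\<^sup>2 + t + 1) + t * (t + 1) + 2 * (2 * t ^ 3 + 4 * t\<^sup>2 + 4 * t + 2)"
    by Groebner_Basis.algebra
  ultimately have "t * (t + 1) = 0" by (simp only: B two mult_zero_left add_0_right add_0_left)
  then have "t = 0 \<or> t = 1" using char2_eq_iff[OF two, of t 1] by auto
  then show False using B by (auto simp: char2_numeral[OF two])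
qed

section \<open>Two-by-two matrices of determinant one\<close>

text \<open>
  Matrices given by their four entries, so that identities between them reduce to polynomial
  identities.
\<close>
definition mat2 :: "'a::zero \<Rightarrow> 'a \<Rightarrow> 'a \<Rightarrow> 'a \<Rightarrow> 'a ^ 2 ^ 2" where
  "mat2 a b c d = vector [vector [a, b], vector [c, d]]"

lemma mat2_eq_iff [simp]:
  "mat2 a b c d = mat2 a' b' c' d' \<longleftrightarrow> a = a' \<and> b = b' \<and> c = c' \<and> d = d'"
  by (auto simp: mat2_def vec_eq_iff forall_2)

lemma mat2_cases:
  obtains a b c d where "M = mat2 a b c d"
proof
  show "M = mat2 (M $ 1 $ 1) (M $ 1 $ 2) (M $ 2 $ 1) (M $ 2 $ 2)"
    by (simp add: mat2_def vec_eq_iff forall_2)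
qed

lemma mat2_mult [simp]:
  "mat2 a b c d ** mat2 a' b' c' d' =
   mat2 (a * a' + b * c') (a * b' + b * d') (c * a' + d * c') (c * b' + d * (d'::'a::semiring_1))"
  by (simp add: mat2_def matrix_matrix_mult_def vec_eq_iff forall_2 sum_2)

lemma det_mat2 [simp]: "det (mat2 a b c d) = a * d - b * (c::'a::comm_ring_1)"
  by (simp add: det_2 mat2_def)

lemma trace_mat2 [simp]: "trace (mat2 a b c d) = a + (d::'a::semiring_1)"
  by (simp add: trace_def sum_2 mat2_def)

lemma mat_1_mat2: "(mat 1 :: 'a::semiring_1 ^ 2 ^ 2) = mat2 1 0 0 1"
  by (simp add: mat2_def mat_def vec_eq_iff forall_2)

abbreviation SL2 :: "('a::field ^ 2 ^ 2) monoid" where "SL2 \<equiv> SL"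

interpretation SL: group "SL :: ('a::field ^ 'n ^ 'n) monoid"
  by (rule group_SL)

lemma SL_simps:
  "A \<in> carrier SL \<longleftrightarrow> det A = 1" "A \<otimes>\<^bsub>SL\<^esub> B = A ** B" "\<one>\<^bsub>SL\<^esub> = mat 1"
  by (simp_all add: SL_def)

lemma inv_mat2:
  assumes "a * d - b * c = (1::'a::field)"
  shows "inv\<^bsub>SL\<^esub> (mat2 a b c d) = mat2 d (- b) (- c) a"
  using assms
  by (intro SL.inv_equality) (simp_all add: SL_simps mat_1_mat2 algebra_simps)

lemma trace_inv_SL2:
  assumes "M \<in> carrier SL2"
  shows "trace (inv\<^bsub>SL\<^esub> M) = trace M"
proof -
  obtain a b c d where M: "M = mat2 a b c d" by (rule mat2_cases)
  show ?thesis using assms by (simp add: M SL_simps inv_mat2)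
qed

lemma trace_conjugate_SL2:
  assumes "M \<in> carrier SL2" "P \<in> carrier SL"
  shows "trace (P \<otimes>\<^bsub>SL\<^esub> M \<otimes>\<^bsub>SL\<^esub> inv\<^bsub>SL\<^esub> P) = trace M"
proof -
  have "trace (P \<otimes>\<^bsub>SL\<^esub> M \<otimes>\<^bsub>SL\<^esub> inv\<^bsub>SL\<^esub> P) = trace (inv\<^bsub>SL\<^esub> P \<otimes>\<^bsub>SL\<^esub> (P \<otimes>\<^bsub>SL\<^esub> M))"
    unfolding SL_simps by (rule trace_mul_sym)
  then show ?thesis using assms by (simp flip: SL.m_assoc)
qed

text \<open>
  The trace identity of Fricke. Its homogeneous form, with the determinants kept as
  variables, is a polynomial identity in the eight entries.
\<close>
lemma trace_commutator_mat2:
  assumes "A \<in> carrier SL2" "B \<in> carrier SL2"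
  shows "trace (A \<otimes>\<^bsub>SL\<^esub> B \<otimes>\<^bsub>SL\<^esub> inv\<^bsub>SL\<^esub> A \<otimes>\<^bsub>SL\<^esub> inv\<^bsub>SL\<^esub> B) =
    (trace A)\<^sup>2 + (trace B)\<^sup>2 + (trace (A \<otimes>\<^bsub>SL\<^esub> B))\<^sup>2 - trace A * trace B * trace (A \<otimes>\<^bsub>SL\<^esub> B) - 2"
proof -
  obtain a b c d where A: "A = mat2 a b c d" by (rule mat2_cases)
  obtain e f g h where B: "B = mat2 e f g h" by (rule mat2_cases)
  have *: "a * d - b * c = 1" "e * h - f * g = 1" using assms by (simp_all add: A B SL_simps)
  let ?T = "a * e + b * g + (c * f + d * h)"
  have "((a * e + b * g) * d + (a * f + b * h) * - c) * h +
        ((a * e + b * g) * - b + (a * f + b * h) * a) * - g +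
        (((c * e + d * g) * d + (c * f + d * h) * - c) * - f +
         ((c * e + d * g) * - b + (c * f + d * h) * a) * e) =
    (e * h - f * g) * (a + d)\<^sup>2 + (a * d - b * c) * (e + h)\<^sup>2 + ?T\<^sup>2 - (a + d) * (e + h) * ?T
      - 2 * (a * d - b * c) * (e * h - f * g)"
    by Groebner_Basis.algebra
  then show ?thesis unfolding A B inv_mat2[OF *(1)] inv_mat2[OF *(2)] SL_simps mat2_mult trace_mat2
    by (simp add: *)
qed

definition frobenius :: "'a ^ 'n ^ 'n \<Rightarrow> 'a::comm_ring_1 ^ 'n ^ 'n" where
  "frobenius M = (\<chi> i j. (M $ i $ j)\<^sup>2)"

lemma frobenius_mat2 [simp]: "frobenius (mat2 a b c d) = mat2 (a\<^sup>2) (b\<^sup>2) (c\<^sup>2) (d\<^sup>2)"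
  by (simp add: frobenius_def mat2_def vec_eq_iff forall_2)

lemma group_hom_frobenius:
  assumes two: "(2::'a::field) = 0"
  shows "group_hom SL2 SL2 (frobenius :: 'a ^ 2 ^ 2 \<Rightarrow> _)"
proof (unfold_locales, rule homI)
  fix M N :: "'a ^ 2 ^ 2" assume M: "M \<in> carrier SL"
  obtain a b c d where M_eq: "M = mat2 a b c d" by (rule mat2_cases)
  obtain a' b' c' d' where N_eq: "N = mat2 a' b' c' d'" by (rule mat2_cases)
  have "a * d + b * c = 1" using M by (simp add: M_eq SL_simps char2_diff[OF two])
  then have "(a * d + b * c)\<^sup>2 = 1" by simp
  then show "frobenius M \<in> carrier SL"
    by (simp add: M_eq SL_simps char2_diff[OF two] char2_square_add[OF two] power_mult_distrib)
  show "frobenius (M \<otimes>\<^bsub>SL\<^esub> N) = frobenius M \<otimes>\<^bsub>SL\<^esub> frobenius N"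
    by (simp add: M_eq N_eq SL_simps char2_square_add[OF two] power_mult_distrib)
qed

lemma trace_frobenius:
  fixes M :: "'a::field ^ 2 ^ 2"
  assumes two: "(2::'a) = 0"
  shows "trace (frobenius M) = (trace M)\<^sup>2"
  by (rule mat2_cases[of M]) (simp add: char2_square_add[OF two])

section \<open>The trace determines the order\<close>

text \<open>
  The matrix \<open>a M + b\<close>. By Cayley and Hamilton, every power of \<open>M\<close> has this form.
\<close>
definition affine2 :: "'a \<Rightarrow> 'a \<Rightarrow> 'a::comm_ring_1 ^ 2 ^ 2 \<Rightarrow> 'a ^ 2 ^ 2" where
  "affine2 a b M = (\<chi> i j. a * M $ i $ j + (if i = j then b else 0))"

lemma affine2_mat2 [simp]:
  "affine2 a b (mat2 p q r s) = mat2 (a * p + b) (a * q) (a * r) (a * s + b)"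
  by (simp add: affine2_def mat2_def vec_eq_iff forall_2)

lemma affine2_mult:
  fixes M :: "'a::field ^ 2 ^ 2"
  assumes "det M = 1"
  shows "affine2 a b M ** affine2 c d M =
    affine2 (a * c * trace M + a * d + b * c) (b * d - a * c) M"
proof -
  obtain p q r s where M: "M = mat2 p q r s" by (rule mat2_cases)
  have det: "p * s - q * r = 1" using assms by (simp add: M)
  show ?thesis unfolding M affine2_mat2 mat2_mult trace_mat2 mat2_eq_iff
    apply (intro conjI)
    subgoal using det by Groebner_Basis.algebra
    subgoal by (simp add: algebra_simps)
    subgoal by (simp add: algebra_simps)
    subgoal using det by Groebner_Basis.algebra
    done
qed

lemma affine2_square:
  fixes M :: "'a::field ^ 2 ^ 2"
  assumes "(2::'a) = 0" "det M = 1"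
  shows "affine2 a b M ** affine2 a b M = affine2 (a\<^sup>2 * trace M) (a\<^sup>2 + b\<^sup>2) M"
  unfolding affine2_mult[OF assms(2)]
  by (simp add: char2_diff[OF assms(1)] power2_eq_square add.commute mult.commute flip: mult_2)
    (simp add: assms(1))

text \<open>
  If \<open>a M + b = 1\<close> with \<open>a \<noteq> 0\<close>, then \<open>M\<close> is a scalar of square \<open>1\<close>, and \<open>1\<close> is the
  only square root of \<open>1\<close> in characteristic two.
\<close>
lemma affine2_eq_oneD:
  fixes M :: "'a::field ^ 2 ^ 2"
  assumes two: "(2::'a) = 0" and M: "M \<in> carrier SL2" "M \<noteq> \<one>\<^bsub>SL\<^esub>" and eq: "affine2 a b M = \<one>\<^bsub>SL\<^esub>"
  shows "a = 0"
proof (rule ccontr)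
  assume a: "a \<noteq> 0"
  obtain p q r s where [simp]: "M = mat2 p q r s" by (rule mat2_cases)
  have "q = 0" "r = 0" "a * p + b = a * s + b" using eq a by (auto simp: SL_simps mat_1_mat2)
  then have "s = p" "q = 0" "r = 0" using a by auto
  moreover from this have "p\<^sup>2 = 1\<^sup>2" using M(1) by (simp add: SL_simps power2_eq_square)
  then have "p = 1" by (rule char2_square_inj[OF two])
  ultimately show False using M(2) by (simp add: SL_simps mat_1_mat2)
qed

lemma SL2_pow:
  fixes M :: "'a::field ^ 2 ^ 2"
  assumes two: "(2::'a) = 0" and M: "M \<in> carrier SL2"
  defines "t \<equiv> trace M"
  shows "M [^]\<^bsub>SL\<^esub> (2::nat) = affine2 t 1 M"
    "M [^]\<^bsub>SL\<^esub> (3::nat) = affine2 (t\<^sup>2 + 1) t M"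
    "M [^]\<^bsub>SL\<^esub> (17::nat) = affine2 (t ^ 16 + t ^ 14 + t ^ 12 + t ^ 8 + 1) (t ^ 15) M"
proof -
  have det: "det M = 1" using M by (simp add: SL_simps)
  have id: "M = affine2 1 0 M" by (rule mat2_cases[of M]) simp
  have add: "M [^]\<^bsub>SL\<^esub> (i + j) = M [^]\<^bsub>SL\<^esub> i ** M [^]\<^bsub>SL\<^esub> j" for i j :: nat
    using SL.nat_pow_mult[OF M] by (simp add: SL_simps)
  have one: "M [^]\<^bsub>SL\<^esub> (1::nat) = affine2 1 0 M" using M id by simp
  note sq = affine2_square[OF two det, folded t_def]
  show 2: "M [^]\<^bsub>SL\<^esub> (2::nat) = affine2 t 1 M"
    using add[of 1 1] unfolding one sq one_add_one by simp
  show "M [^]\<^bsub>SL\<^esub> (3::nat) = affine2 (t\<^sup>2 + 1) t M"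
    using add[of 2 1] unfolding one 2 affine2_mult[OF det] t_def[symmetric]
    by (simp add: char2_uminus[OF two] power2_eq_square)
  have 4: "M [^]\<^bsub>SL\<^esub> (4::nat) = affine2 (t ^ 3) (t\<^sup>2 + 1) M"
    using add[of 2 2] unfolding 2 sq by (simp flip: power_Suc2)
  have 8: "M [^]\<^bsub>SL\<^esub> (8::nat) = affine2 (t ^ 7) (t ^ 6 + t ^ 4 + 1) M"
    using add[of 4 4] unfolding 4 sq by (simp add: char2_square_add[OF two] add.assoc flip: power_Suc2 power_mult)
  have 16: "M [^]\<^bsub>SL\<^esub> (16::nat) = affine2 (t ^ 15) (t ^ 14 + t ^ 12 + t ^ 8 + 1) M"
    using add[of 8 8] unfolding 8 sq by (simp add: char2_square_add[OF two] add.assoc flip: power_Suc2 power_mult)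
  show "M [^]\<^bsub>SL\<^esub> (17::nat) = affine2 (t ^ 16 + t ^ 14 + t ^ 12 + t ^ 8 + 1) (t ^ 15) M"
    using add[of 16 1] unfolding one 16 affine2_mult[OF det] t_def[symmetric]
    by (simp add: char2_uminus[OF two] add.assoc flip: power_Suc2)
qed

lemma trace_involution:
  fixes M :: "'a::field ^ 2 ^ 2"
  assumes two: "(2::'a) = 0" and M: "M \<in> carrier SL2" "M [^]\<^bsub>SL\<^esub> (2::nat) = \<one>\<^bsub>SL\<^esub>"
  shows "trace M = 0"
proof (cases "M = \<one>\<^bsub>SL\<^esub>")
  case True
  then show ?thesis by (simp add: SL_simps mat_1_mat2 two)
next
  case False
  then show ?thesis using affine2_eq_oneD[OF two M(1)] M(2) SL2_pow(1)[OF two M(1)] by metis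
qed

lemma trace_order_3:
  fixes M :: "'a::field ^ 2 ^ 2"
  assumes two: "(2::'a) = 0" and M: "M \<in> carrier SL2" "M [^]\<^bsub>SL\<^esub> (3::nat) = \<one>\<^bsub>SL\<^esub>" "M \<noteq> \<one>\<^bsub>SL\<^esub>"
  shows "trace M = 1"
proof -
  have "(trace M)\<^sup>2 + 1 = 0"
    using affine2_eq_oneD[OF two M(1,3)] M(2) SL2_pow(2)[OF two M(1)] by metis
  then have "(trace M)\<^sup>2 = 1\<^sup>2" by (simp add: char2_eq_iff[OF two])
  then show ?thesis by (rule char2_square_inj[OF two])
qed

text \<open>
  The coefficient of \<open>M\<close> in \<open>M ^ 17\<close> is the square of the octic evaluated at the trace.
\<close>
lemma trace_order_17:
  fixes M :: "'a::field ^ 2 ^ 2"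
  assumes two: "(2::'a) = 0" and M: "M \<in> carrier SL2" "M [^]\<^bsub>SL\<^esub> (17::nat) = \<one>\<^bsub>SL\<^esub>" "M \<noteq> \<one>\<^bsub>SL\<^esub>"
  shows "trace M ^ 8 + trace M ^ 7 + trace M ^ 6 + trace M ^ 4 + 1 = 0"
proof -
  let ?t = "trace M"
  have "?t ^ 16 + ?t ^ 14 + ?t ^ 12 + ?t ^ 8 + 1 = 0"
    using affine2_eq_oneD[OF two M(1,3)] M(2) SL2_pow(3)[OF two M(1)] by metis
  also have "?t ^ 16 + ?t ^ 14 + ?t ^ 12 + ?t ^ 8 + 1 = (?t ^ 8 + ?t ^ 7 + ?t ^ 6 + ?t ^ 4 + 1)\<^sup>2"
    by (simp add: char2_square_add[OF two] flip: power_mult)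
  finally show ?thesis by simp
qed

lemma order_17_trace:
  fixes M :: "'a::field ^ 2 ^ 2"
  assumes two: "(2::'a) = 0" and M: "M \<in> carrier SL2" and t: "trace M ^ 4 + trace M + 1 = 0"
  shows "group.ord SL M = 17"
proof -
  have "M [^]\<^bsub>SL\<^esub> (17::nat) = affine2 0 1 M"
    unfolding SL2_pow(3)[OF two M] by (simp only: char2_quartic_root_facts(1,2)[OF two t])
  also have "\<dots> = \<one>\<^bsub>SL\<^esub>" by (rule mat2_cases[of M]) (simp add: SL_simps mat_1_mat2)
  finally have "group.ord SL M dvd 17" using SL.pow_eq_id[OF M] by simp
  moreover have "M \<noteq> \<one>\<^bsub>SL\<^esub>" using t by (auto simp: SL_simps mat_1_mat2 two)
  then have "group.ord SL M \<noteq> 1" using SL.ord_eq_1[OF M] by simp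
  moreover have "prime (17::nat)" by (simp add: prime_nat_numeral_eq)
  ultimately show ?thesis by (metis prime_nat_iff)
qed

section \<open>Conjugacy, generation and simplicity\<close>

text \<open>
  For a vector \<open>v\<close>, the matrix \<open>P\<close> with columns \<open>v\<close> and \<open>M v\<close> conjugates the companion
  matrix into \<open>M\<close>. The determinant of \<open>P\<close> is a quadratic form in \<open>v\<close>, which is nonzero since
  \<open>M\<close> is not a scalar, and every element is a square, so some \<open>v\<close> gives determinant \<open>1\<close>.
\<close>
lemma conjugate_companion:
  fixes M :: "'a::{field,finite} ^ 2 ^ 2"
  assumes two: "(2::'a) = 0" and M: "M \<in> carrier SL2" "M \<noteq> \<one>\<^bsub>SL\<^esub>"
  shows "\<exists>P\<in>carrier SL. M = P \<otimes>\<^bsub>SL\<^esub> mat2 0 1 1 (trace M) \<otimes>\<^bsub>SL\<^esub> inv\<^bsub>SL\<^esub> P"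
proof -
  obtain a b c d where M_eq [simp]: "M = mat2 a b c d" by (rule mat2_cases)
  have det: "a * d - b * c = 1" using M(1) by (simp add: SL_simps)
  define P where "P x y = mat2 x (a * x + b * y) y (c * x + d * y)" for x y
  have "\<exists>x y. c * x\<^sup>2 + (a + d) * x * y + b * y\<^sup>2 = 1"
  proof -
    have root: "\<exists>s. k * s\<^sup>2 = 1" if "k \<noteq> 0" for k :: 'a
    proof -
      obtain s where "s\<^sup>2 = 1 / k" by (rule char2_square_surj[OF two])
      then show ?thesis using that by (intro exI[of _ s]) simp
    qed
    consider "c \<noteq> 0" | "b \<noteq> 0" | "b = 0" "c = 0" by blast
    then show ?thesis
    proof cases
      case 1
      then obtain s where "c * s\<^sup>2 = 1" using root by blast
      then show ?thesis by (intro exI[of _ s] exI[of _ 0]) simp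
    next
      case 2
      then obtain s where "b * s\<^sup>2 = 1" using root by blast
      then show ?thesis by (intro exI[of _ s] exI[of _ 0]) simp
    next
      case 3
      have "a + d \<noteq> 0"
      proof
        assume "a + d = 0"
        then have "d = a" by (simp add: char2_eq_iff[OF two])
        then have "a\<^sup>2 = 1\<^sup>2" using det 3 by (simp add: power2_eq_square)
        then have "a = 1" by (rule char2_square_inj[OF two])
        then show False using M(2) 3 \<open>d = a\<close> by (simp add: SL_simps mat_1_mat2)
      qed
      then obtain s where "(a + d) * s\<^sup>2 = 1" using root by blast
      then show ?thesis using 3 by (intro exI[of _ s]) (simp add: power2_eq_square mult.assoc)
    qed
  qed
  then obtain x y where xy: "c * x\<^sup>2 + (a + d) * x * y + b * y\<^sup>2 = 1" by blast
  have "det (P x y) = c * x\<^sup>2 + (a + d) * x * y + b * y\<^sup>2 - 2 * (a * x * y + b * y\<^sup>2)"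
    unfolding P_def det_mat2 by Groebner_Basis.algebra
  then have P: "P x y \<in> carrier SL" using xy by (simp add: SL_simps two)
  have C: "mat2 0 1 1 (trace M) \<in> carrier SL2" by (simp add: SL_simps char2_uminus[OF two])
  have "a * (a * x + b * y) + b * (c * x + d * y) = x + (a * x + b * y) * (a + d) - 2 * x"
    "c * (a * x + b * y) + d * (c * x + d * y) = y + (c * x + d * y) * (a + d) - 2 * y"
    using det by (Groebner_Basis.algebra, Groebner_Basis.algebra)
  then have "M \<otimes>\<^bsub>SL\<^esub> P x y = P x y \<otimes>\<^bsub>SL\<^esub> mat2 0 1 1 (trace M)"
    by (simp add: P_def SL_simps two)
  then have "M = P x y \<otimes>\<^bsub>SL\<^esub> mat2 0 1 1 (trace M) \<otimes>\<^bsub>SL\<^esub> inv\<^bsub>SL\<^esub> P x y"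
    using M(1) P C by (simp add: SL.inv_solve_right)
  then show ?thesis using P by blast
qed

lemma conjugate_if_trace_eq:
  fixes M N :: "'a::{field,finite} ^ 2 ^ 2"
  assumes two: "(2::'a) = 0" and M: "M \<in> carrier SL" "M \<noteq> \<one>\<^bsub>SL\<^esub>" and N: "N \<in> carrier SL" "N \<noteq> \<one>\<^bsub>SL\<^esub>"
    and tr: "trace M = trace N"
  shows "\<exists>P\<in>carrier SL. N = P \<otimes>\<^bsub>SL\<^esub> M \<otimes>\<^bsub>SL\<^esub> inv\<^bsub>SL\<^esub> P"
proof -
  let ?C = "mat2 0 1 1 (trace N)"
  have C: "?C \<in> carrier SL" by (simp add: SL_simps char2_uminus[OF two])
  obtain P where P: "P \<in> carrier SL" "M = P \<otimes>\<^bsub>SL\<^esub> ?C \<otimes>\<^bsub>SL\<^esub> inv\<^bsub>SL\<^esub> P"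
    using conjugate_companion[OF two M] tr by auto
  obtain Q where Q: "Q \<in> carrier SL" "N = Q \<otimes>\<^bsub>SL\<^esub> ?C \<otimes>\<^bsub>SL\<^esub> inv\<^bsub>SL\<^esub> Q"
    using conjugate_companion[OF two N] by auto
  have "?C = inv\<^bsub>SL\<^esub> P \<otimes>\<^bsub>SL\<^esub> M \<otimes>\<^bsub>SL\<^esub> P"
    unfolding P(2) using P(1) C by (simp add: SL.m_assoc) (simp flip: SL.m_assoc)
  then have "N = (Q \<otimes>\<^bsub>SL\<^esub> inv\<^bsub>SL\<^esub> P) \<otimes>\<^bsub>SL\<^esub> M \<otimes>\<^bsub>SL\<^esub> inv\<^bsub>SL\<^esub> (Q \<otimes>\<^bsub>SL\<^esub> inv\<^bsub>SL\<^esub> P)"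
    using Q P(1) M(1) by (simp add: SL.m_assoc SL.inv_mult_group)
  then show ?thesis using Q P by (intro bexI[of _ "Q \<otimes>\<^bsub>SL\<^esub> inv\<^bsub>SL\<^esub> P"]) auto
qed

text \<open>
  A matrix with lower left entry \<open>c \<noteq> 0\<close> is a product of three transvections; adding
  the first row to the second reduces the remaining case \<open>c = 0\<close> to this one.
\<close>
lemma SL2_generated_by_transvections:
  fixes H :: "('a::field ^ 2 ^ 2) set"
  assumes H: "subgroup H SL" and up: "\<And>r. mat2 1 r 0 1 \<in> H" and low: "\<And>r. mat2 1 0 r 1 \<in> H"
  shows "H = carrier SL"
proof
  show "H \<subseteq> carrier SL" by (rule subgroup.subset[OF H])
  have mult: "A ** B \<in> H" if "A \<in> H" "B \<in> H" for A B
    using subgroup.m_closed[OF H that] by (simp add: SL_simps)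
  have lower_nz: "mat2 a b c d \<in> H" if "a * d - b * c = 1" "c \<noteq> 0" for a b c d
  proof -
    have "mat2 1 ((a - 1) / c) 0 1 ** mat2 1 0 c 1 ** mat2 1 ((d - 1) / c) 0 1 \<in> H"
      by (intro mult up low)
    also have "mat2 1 ((a - 1) / c) 0 1 ** mat2 1 0 c 1 ** mat2 1 ((d - 1) / c) 0 1 = mat2 a b c d"
      using that by (simp add: field_simps)
    finally show ?thesis .
  qed
  show "carrier SL \<subseteq> H"
  proof
    fix M :: "'a ^ 2 ^ 2" assume M: "M \<in> carrier SL"
    obtain a b c d where M_eq: "M = mat2 a b c d" by (rule mat2_cases)
    have det: "a * d - b * c = 1" using M by (simp add: M_eq SL_simps)
    show "M \<in> H"
    proof (cases "c = 0")
      case True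
      with det have "a \<noteq> 0" by auto
      then have "mat2 a b (a + c) (b + d) \<in> H" using det True by (intro lower_nz) (auto simp: algebra_simps)
      then have "mat2 1 0 (-1) 1 ** mat2 a b (a + c) (b + d) \<in> H" by (intro mult low)
      then show ?thesis by (simp add: M_eq)
    qed (use lower_nz det in \<open>simp add: M_eq\<close>)
  qed
qed

lemma weyl_conjugates_transvection:
  assumes two: "(2::'a::field) = 0"
  shows "mat2 0 1 1 0 \<otimes>\<^bsub>SL\<^esub> mat2 1 r 0 1 \<otimes>\<^bsub>SL\<^esub> inv\<^bsub>SL\<^esub> mat2 0 1 1 0 = mat2 1 0 (r::'a) 1"
  using two by (simp add: inv_mat2 char2_uminus SL_simps)

lemma SL2_generated_by_upper_transvections:
  assumes two: "(2::'a::field) = 0" and H: "subgroup H SL"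
    and up: "\<And>r::'a. mat2 1 r 0 1 \<in> H"
    and low: "\<And>r. mat2 0 1 1 0 \<otimes>\<^bsub>SL\<^esub> mat2 1 r 0 1 \<otimes>\<^bsub>SL\<^esub> inv\<^bsub>SL\<^esub> mat2 0 1 1 0 \<in> H"
  shows "H = carrier SL"
  using H up low unfolding weyl_conjugates_transvection[OF two]
  by (rule SL2_generated_by_transvections)

text \<open>
  Write \<open>A\<close> and \<open>B\<close> for the two generators and \<open>u r\<close> for the upper transvection with entry
  \<open>r\<close>. Then \<open>B = u 1 W\<close> with the Weyl element \<open>W\<close>, which inverts \<open>A\<close>; hence
  \<open>A B A B\<^sup>-\<^sup>1\<close> is the transvection \<open>u (l ^ 2 + 1)\<close>. Conjugation by powers of
  \<open>A\<close> multiplies the entry by all nonzero squares, that is, by all nonzero elements. So all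
  upper transvections are obtained, and with them \<open>W\<close>.
\<close>
lemma steinberg_generators:
  assumes two: "(2::'a::{field,finite}) = 0" and l: "l \<noteq> 0" "l \<noteq> 1"
    and gen: "\<And>x::'a. x \<noteq> 0 \<Longrightarrow> \<exists>i::nat. x = l ^ i"
    and H: "subgroup H SL" and A: "mat2 l 0 0 (1 / l) \<in> H" and B: "mat2 1 1 1 0 \<in> H"
  shows "H = carrier SL"
proof (rule SL2_generated_by_upper_transvections[OF two H])
  interpret H: subgroup H SL by (rule H)
  have mult: "X ** Y \<in> H" if "X \<in> H" "Y \<in> H" for X Y
    using subgroup.m_closed[OF H that] by (simp add: SL_simps)
  let ?A = "mat2 l 0 0 (1 / l)" and ?B = "mat2 1 1 1 0 :: 'a ^ 2 ^ 2"
  have Binv: "mat2 0 1 1 1 \<in> H"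
    using subgroup.m_inv_closed[OF H B] two by (simp add: inv_mat2 char2_uminus)
  have Ainv: "mat2 (1 / l) 0 0 l \<in> H"
    using subgroup.m_inv_closed[OF H A] l by (simp add: inv_mat2)
  have "l\<^sup>2 \<noteq> 1\<^sup>2" using l(2) char2_square_inj[OF two, of l 1] by blast
  then have l2: "l\<^sup>2 + 1 \<noteq> 0" by (simp add: char2_eq_iff[OF two])
  \<comment> \<open>as \<open>W\<close> inverts \<open>A\<close>, the diagonal parts of this product cancel\<close>
  have "?A ** ?B ** ?A ** mat2 0 1 1 1 \<in> H" by (intro mult A B Binv)
  also have "?A ** ?B ** ?A ** mat2 0 1 1 1 = mat2 1 (l\<^sup>2 + 1) 0 1"
    using l(1) two by (simp add: power2_eq_square add.commute)
  finally have base: "mat2 1 (l\<^sup>2 + 1) 0 1 \<in> H" .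
  have powers: "mat2 1 ((l ^ i)\<^sup>2 * (l\<^sup>2 + 1)) 0 1 \<in> H" for i :: nat
  proof (induction i)
    case (Suc i)
    have "?A ** mat2 1 ((l ^ i)\<^sup>2 * (l\<^sup>2 + 1)) 0 1 ** mat2 (1 / l) 0 0 l \<in> H"
      by (intro mult A Ainv Suc)
    also have "?A ** mat2 1 ((l ^ i)\<^sup>2 * (l\<^sup>2 + 1)) 0 1 ** mat2 (1 / l) 0 0 l =
        mat2 1 ((l ^ Suc i)\<^sup>2 * (l\<^sup>2 + 1)) 0 1"
      using l(1) by (simp add: power2_eq_square mult_ac)
    finally show ?case .
  qed (use base in simp)
  show up: "mat2 1 r 0 1 \<in> H" for r
  proof (cases "r = 0")
    case True
    then show ?thesis using subgroup.one_closed[OF H] by (simp add: SL_simps mat_1_mat2)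
  next
    case False
    obtain s where s: "s\<^sup>2 = r / (l\<^sup>2 + 1)" by (rule char2_square_surj[OF two])
    have "s \<noteq> 0" using s False l2 by auto
    then obtain i where "s = l ^ i" using gen by blast
    then show ?thesis using powers[of i] s l2 by simp
  qed
  have "mat2 1 1 0 1 ** ?B \<in> H" by (intro mult up B)
  then have w: "mat2 0 1 1 0 \<in> H" using two by simp
  show "mat2 0 1 1 0 \<otimes>\<^bsub>SL\<^esub> mat2 1 r 0 1 \<otimes>\<^bsub>SL\<^esub> inv\<^bsub>SL\<^esub> mat2 0 1 1 0 \<in> H" for r
    by (intro H.m_closed H.m_inv_closed w up)
qed

text \<open>
  A nontrivial normal subgroup contains a companion matrix by conjugacy. Its commutator with
  a diagonal matrix is upper triangular with distinct diagonal entries, and the commutators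
  of the latter with transvections are all the upper transvections.
\<close>
lemma simple_SL2:
  assumes two: "(2::'a::{field,finite}) = 0" and m: "(m::'a) \<noteq> 0" "m \<noteq> 1"
  shows "simple_group (SL :: ('a ^ 2 ^ 2) monoid)"
proof (unfold_locales)
  let ?S = "SL :: ('a ^ 2 ^ 2) monoid"
  have "{mat2 1 0 0 1, mat2 1 1 0 1} \<subseteq> carrier ?S" by (simp add: SL_simps)
  then have "card {mat2 1 0 0 1, mat2 1 1 0 (1::'a)} \<le> card (carrier ?S)"
    by (intro card_mono) (rule finite)
  then show "1 < order ?S" by (simp add: order_def)
next
  fix N :: "('a ^ 2 ^ 2) set" assume N: "N \<lhd> SL"
  interpret N: normal N SL by (rule N)
  have H: "subgroup N SL" by (rule N.subgroup_axioms)
  have conj: "P \<otimes>\<^bsub>SL\<^esub> M \<otimes>\<^bsub>SL\<^esub> inv\<^bsub>SL\<^esub> P \<in> N" if "P \<in> carrier SL" "M \<in> N" for P M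
    using N.inv_op_closed2[OF that] .
  have comm: "inv\<^bsub>SL\<^esub> M \<otimes>\<^bsub>SL\<^esub> (P \<otimes>\<^bsub>SL\<^esub> M \<otimes>\<^bsub>SL\<^esub> inv\<^bsub>SL\<^esub> P) \<in> N" if "P \<in> carrier SL" "M \<in> N" for P M
    by (intro N.m_closed N.m_inv_closed conj that)
  show "N = carrier SL \<or> N = {\<one>\<^bsub>SL\<^esub>}"
  proof (rule disjCI)
    assume "N \<noteq> {\<one>\<^bsub>SL\<^esub>}"
    then obtain M where M: "M \<in> N" "M \<noteq> \<one>\<^bsub>SL\<^esub>" using N.one_closed by blast
    define t where "t = trace M"
    have MS: "M \<in> carrier SL" using M(1) by (rule N.mem_carrier)
    obtain P where P: "P \<in> carrier SL"
      and eq: "M = P \<otimes>\<^bsub>SL\<^esub> mat2 0 1 1 t \<otimes>\<^bsub>SL\<^esub> inv\<^bsub>SL\<^esub> P"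
      using conjugate_companion[OF two MS M(2)] unfolding t_def by blast
    have C: "mat2 0 1 1 t \<in> carrier SL" by (simp add: SL_simps char2_uminus[OF two])
    have "inv\<^bsub>SL\<^esub> P \<otimes>\<^bsub>SL\<^esub> M \<otimes>\<^bsub>SL\<^esub> inv\<^bsub>SL\<^esub> (inv\<^bsub>SL\<^esub> P) \<in> N" by (intro conj SL.inv_closed P M(1))
    also have "inv\<^bsub>SL\<^esub> P \<otimes>\<^bsub>SL\<^esub> M \<otimes>\<^bsub>SL\<^esub> inv\<^bsub>SL\<^esub> (inv\<^bsub>SL\<^esub> P) = mat2 0 1 1 t"
      unfolding eq using P C by (simp add: SL.m_assoc SL.inv_solve_left')
    finally have CN: "mat2 0 1 1 t \<in> N" .
    \<comment> \<open>the diagonal entry and the upper right entry of the commutator of the companion matrix with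
      the diagonal matrix with entries \<open>m\<close> and \<open>1 / m\<close>\<close>
    define p where "p = (1 / m)\<^sup>2"
    define s where "s = t * m\<^sup>2 + t"
    have p: "p \<noteq> 0" using m by (simp add: p_def)
    have "mat2 m 0 0 (1 / m) \<in> carrier SL" using m by (simp add: SL_simps)
    from comm[OF this CN] have T: "mat2 p s 0 (1 / p) \<in> N"
      using m by (simp add: inv_mat2 SL_simps char2_uminus[OF two] p_def s_def power2_eq_square mult_ac)
    have "m\<^sup>2 \<noteq> 1\<^sup>2" using m char2_square_inj[OF two, of m 1] by blast
    then have "p\<^sup>2 \<noteq> 1\<^sup>2" using m char2_square_inj[OF two, of p 1] by (auto simp: p_def power_one_over)
    then have p2: "1 / p\<^sup>2 + 1 \<noteq> 0" using p by (simp add: field_simps char2_eq_iff[OF two])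
    have up: "mat2 1 r 0 1 \<in> N" for r
    proof -
      define x where "x = r / (1 / p\<^sup>2 + 1)"
      have "mat2 1 x 0 1 \<in> carrier SL" by (simp add: SL_simps)
      from comm[OF this T] have "mat2 1 (x * (1 / p\<^sup>2 + 1)) 0 1 \<in> N"
        using p two by (simp add: inv_mat2 SL_simps char2_uminus power2_eq_square field_simps)
      then show ?thesis using p2 by (simp add: x_def)
    qed
    show "N = carrier SL"
      using up by (intro SL2_generated_by_upper_transvections[OF two H] conj) (simp_all add: SL_simps char2_uminus[OF two])
  qed
qed

section \<open>Separating one homomorphism onto a simple group from the others\<close>

text \<open>
  The image in the simple group of a normal subgroup outside the kernel of \<open>f\<close> is the whole
  group. This persists for intersections: if \<open>M\<close> and \<open>N\<close> both map onto \<open>G\<close>, then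
  \<open>M \<inter> N\<close> contains the commutators \<open>[x, y]\<close> with \<open>x \<in> M\<close> and \<open>y \<in> N\<close>, and one
  of them has a nontrivial image because \<open>G\<close> is not commutative.
\<close>
lemma avoid_kernels:
  assumes "group F" and "simple_group G" and ab: "a \<in> carrier G" "b \<in> carrier G" "a \<otimes>\<^bsub>G\<^esub> b \<noteq> b \<otimes>\<^bsub>G\<^esub> a"
    and f: "f \<in> hom F G" and surj: "f ` carrier F = carrier G"
    and "finite K" and "\<And>N. N \<in> K \<Longrightarrow> N \<lhd> F \<and> \<not> N \<subseteq> kernel F G f"
  shows "\<exists>M. M \<lhd> F \<and> (\<forall>N\<in>K. M \<subseteq> N) \<and> f ` M = carrier G"
proof -
  interpret F: group F by fact
  interpret G: simple_group G by fact
  interpret f: group_hom F G f by unfold_locales (rule f)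
  have image_normal: "f ` N \<lhd> G" if "N \<lhd> F" for N
  proof -
    interpret N: normal N F by (rule that)
    have "f x \<otimes>\<^bsub>G\<^esub> f u \<otimes>\<^bsub>G\<^esub> inv\<^bsub>G\<^esub> f x \<in> f ` N" if "x \<in> carrier F" "u \<in> N" for x u
    proof (rule image_eqI)
      show "x \<otimes>\<^bsub>F\<^esub> u \<otimes>\<^bsub>F\<^esub> inv\<^bsub>F\<^esub> x \<in> N" by (rule N.inv_op_closed2[OF that])
      show "f x \<otimes>\<^bsub>G\<^esub> f u \<otimes>\<^bsub>G\<^esub> inv\<^bsub>G\<^esub> f x = f (x \<otimes>\<^bsub>F\<^esub> u \<otimes>\<^bsub>F\<^esub> inv\<^bsub>F\<^esub> x)"
        using that N.mem_carrier[OF that(2)] by simp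
    qed
    then have "\<forall>y\<in>f ` carrier F. \<forall>v\<in>f ` N. y \<otimes>\<^bsub>G\<^esub> v \<otimes>\<^bsub>G\<^esub> inv\<^bsub>G\<^esub> y \<in> f ` N"
      by (intro ballI) (elim imageE, simp only:)
    moreover have "subgroup (f ` N) G"
      by (rule f.subgroup_img_is_subgroup[OF N.subgroup_axioms])
    ultimately show ?thesis unfolding G.normal_inv_iff surj by (intro conjI)
  qed
  have image: "f ` N = carrier G" if N: "N \<lhd> F" "\<not> N \<subseteq> kernel F G f" for N
  proof -
    have "f ` N \<noteq> {\<one>\<^bsub>G\<^esub>}"
      using N normal_imp_subgroup[OF N(1)] by (auto simp: kernel_def dest: subgroup.mem_carrier)
    then show ?thesis using G.no_real_normal_subgroup[OF image_normal[OF N(1)]] by blast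
  qed
  show ?thesis using assms(8,9)
  proof (induction K rule: finite_induct)
    case empty
    then show ?case using F.normal_self surj by blast
  next
    case (insert N K)
    then obtain M where M: "M \<lhd> F" "\<forall>N\<in>K. M \<subseteq> N" "f ` M = carrier G" by blast
    have N: "N \<lhd> F" "f ` N = carrier G" using insert.prems image by blast+
    obtain x y where xy: "x \<in> M" "y \<in> N" "f x = a" "f y = b"
      using M(3) N(2) ab(1,2) by (metis imageE)
    interpret M: normal M F by fact
    interpret N: normal N F by fact
    have mn: "M \<inter> N \<lhd> F" using F.normal_subgroup_intersect M(1) N(1) by blast
    let ?c = "x \<otimes>\<^bsub>F\<^esub> y \<otimes>\<^bsub>F\<^esub> inv\<^bsub>F\<^esub> x \<otimes>\<^bsub>F\<^esub> inv\<^bsub>F\<^esub> y"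
    have xy': "x \<in> carrier F" "y \<in> carrier F" using xy by auto
    have "x \<otimes>\<^bsub>F\<^esub> (y \<otimes>\<^bsub>F\<^esub> inv\<^bsub>F\<^esub> x \<otimes>\<^bsub>F\<^esub> inv\<^bsub>F\<^esub> y) \<in> M"
      using xy xy' by (intro M.m_closed M.inv_op_closed2 M.m_inv_closed)
    then have "?c \<in> M" using xy' by (simp add: F.m_assoc)
    moreover have "?c \<in> N"
      using xy xy' by (intro N.m_closed N.inv_op_closed2 N.m_inv_closed)
    moreover have "f ?c \<noteq> \<one>\<^bsub>G\<^esub>"
    proof
      assume "f ?c = \<one>\<^bsub>G\<^esub>"
      then have "a \<otimes>\<^bsub>G\<^esub> b \<otimes>\<^bsub>G\<^esub> inv\<^bsub>G\<^esub> a \<otimes>\<^bsub>G\<^esub> inv\<^bsub>G\<^esub> b = \<one>\<^bsub>G\<^esub>"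
        using xy xy' by simp
      then have "a \<otimes>\<^bsub>G\<^esub> b = b \<otimes>\<^bsub>G\<^esub> a"
        using ab(1,2) by (metis G.inv_solve_right G.inv_closed G.l_one G.m_closed G.inv_inv G.one_closed)
      then show False using ab(3) by blast
    qed
    ultimately have "\<not> M \<inter> N \<subseteq> kernel F G f" by (auto simp: kernel_def)
    then have "f ` (M \<inter> N) = carrier G" using image mn by blast
    then show ?case using mn M(2) by blast
  qed
qed

text \<open>
  The inclusion of the kernels makes \<open>f\<close> factor through \<open>h\<close>. The image of \<open>h\<close> is thus at
  least as large as \<open>G\<close>, and by finiteness the factor map is a bijection.
\<close>
lemma kernel_eq_of_subset:
  assumes "group F" "group G" "finite (carrier G)"
    and f: "f \<in> hom F G" "f ` carrier F = carrier G" and h: "h \<in> hom F G"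
    and sub: "kernel F G h \<subseteq> kernel F G f"
  shows "kernel F G h = kernel F G f"
proof -
  interpret F: group F by fact
  interpret G: group G by fact
  interpret f: group_hom F G f by unfold_locales (rule f)
  interpret h: group_hom F G h by unfold_locales (rule h)
  have eqI: "f u = f v" if "u \<in> carrier F" "v \<in> carrier F" "h u = h v" for u v
  proof -
    have "u \<otimes>\<^bsub>F\<^esub> inv\<^bsub>F\<^esub> v \<in> kernel F G h" using that by (simp add: kernel_def)
    then have "f (u \<otimes>\<^bsub>F\<^esub> inv\<^bsub>F\<^esub> v) = \<one>\<^bsub>G\<^esub>" using sub unfolding kernel_def by blast
    then have "f u \<otimes>\<^bsub>G\<^esub> inv\<^bsub>G\<^esub> f v = \<one>\<^bsub>G\<^esub>" using that by simp
    then show ?thesis using that by (simp add: G.inv_solve_right')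
  qed
  define r where "r y = f (SOME u. u \<in> carrier F \<and> h u = y)" for y
  have r: "r (h u) = f u" if "u \<in> carrier F" for u
  proof -
    have "(SOME v. v \<in> carrier F \<and> h v = h u) \<in> carrier F \<and> h (SOME v. v \<in> carrier F \<and> h v = h u) = h u"
      by (rule someI[of _ u]) (simp add: that)
    then show ?thesis unfolding r_def by (intro eqI that) auto
  qed
  have im: "r ` (h ` carrier F) = carrier G" using r f(2) by (auto simp: image_image)
  have sub': "h ` carrier F \<subseteq> carrier G" by auto
  have fin: "finite (h ` carrier F)" by (rule finite_subset[OF sub' assms(3)])
  have "card (h ` carrier F) \<le> card (r ` (h ` carrier F))"
    unfolding im by (rule card_mono[OF assms(3) sub'])
  then have "inj_on r (h ` carrier F)"
    using card_image_le[OF fin, of r] by (intro eq_card_imp_inj_on fin) linarith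
  moreover have "r (h u) = r (h \<one>\<^bsub>F\<^esub>)" if "u \<in> carrier F" "f u = f \<one>\<^bsub>F\<^esub>" for u
    unfolding r[OF that(1)] r[OF F.one_closed] by (rule that(2))
  ultimately have "h u = h \<one>\<^bsub>F\<^esub>" if "u \<in> carrier F" "f u = f \<one>\<^bsub>F\<^esub>" for u
    using that by (meson inj_onD imageI F.one_closed)
  then have "kernel F G f \<subseteq> kernel F G h" by (auto simp: kernel_def)
  with sub show ?thesis by blast
qed

text \<open>
  Every homomorphism \<open>h\<close> other than those that satisfy exactly the same relations as \<open>f\<close> can
  be killed at \<open>w\<close>, while the value of \<open>f\<close> at \<open>w\<close> is arbitrary.
\<close>
lemma separating_element:
  assumes "group F" and "simple_group G" and ab: "a \<in> carrier G" "b \<in> carrier G" "a \<otimes>\<^bsub>G\<^esub> b \<noteq> b \<otimes>\<^bsub>G\<^esub> a"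
    and fin: "finite (carrier G)"
    and f: "f \<in> hom F G" "f ` carrier F = carrier G"
    and E: "E \<subseteq> hom F G" "finite (kernel F G ` E)" and c: "c \<in> carrier G"
  shows "\<exists>w\<in>carrier F. f w = c \<and> (\<forall>h\<in>E. h w = \<one>\<^bsub>G\<^esub> \<or> kernel F G h = kernel F G f)"
proof -
  interpret G: simple_group G by fact
  define K where "K = {N \<in> kernel F G ` E. \<not> N \<subseteq> kernel F G f}"
  have finK: "finite K" using E(2) by (simp add: K_def)
  have normal: "N \<lhd> F \<and> \<not> N \<subseteq> kernel F G f" if "N \<in> K" for N
    using that E(1) \<open>group F\<close> G.is_group unfolding K_def
    by (auto intro!: group_hom.normal_kernel simp: group_hom_def group_hom_axioms_def)
  obtain M where M: "M \<lhd> F" "\<forall>N\<in>K. M \<subseteq> N" "f ` M = carrier G"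
    using avoid_kernels[OF assms(1,2) ab f finK normal] by blast
  obtain w where w: "w \<in> M" "f w = c" using c M(3) by (metis imageE)
  have wF: "w \<in> carrier F" using normal_imp_subgroup[OF M(1)] w(1) by (rule subgroup.mem_carrier)
  have "h w = \<one>\<^bsub>G\<^esub> \<or> kernel F G h = kernel F G f" if h: "h \<in> E" for h
  proof (cases "kernel F G h \<subseteq> kernel F G f")
    case True
    then show ?thesis
      using kernel_eq_of_subset[OF assms(1) G.is_group fin f] h E(1) by blast
  next
    case False
    then have "kernel F G h \<in> K" using h by (simp add: K_def)
    then have "w \<in> kernel F G h" using M(2) w(1) by blast
    then show ?thesis by (simp add: kernel_def)
  qed
  then show ?thesis using w(2) wF by blast
qed

section \<open>Evaluation of words\<close>

lemma letters_free_group: "w \<in> carrier (free_group k) \<Longrightarrow> fst ` set w \<subseteq> {..<k}"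
  by (simp add: free_group_def)

lemma eval_word_cong:
  "(\<And>i. i \<in> fst ` set w \<Longrightarrow> g i = g' i) \<Longrightarrow> eval_word G g w = eval_word G g' w"
  by (induction w) (simp_all add: eval_word_def eval_letter_def)

lemma eval_word_one:
  assumes "group G"
  shows "eval_word G (\<lambda>i. \<one>\<^bsub>G\<^esub>) w = \<one>\<^bsub>G\<^esub>"
proof -
  interpret group G by fact
  show ?thesis by (induction w) (simp_all add: eval_word_def eval_letter_def)
qed

lemma eval_word_image:
  assumes "group_hom G H \<phi>" and g: "g \<in> {..<k} \<rightarrow> carrier G" and "fst ` set w \<subseteq> {..<k}"
  shows "eval_word H (\<phi> \<circ> g) w = \<phi> (eval_word G g w)"
proof -
  interpret \<phi>: group_hom G H \<phi> by fact
  show ?thesis using assms(3)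
  proof (induction w)
    case (Cons a w)
    have "g (fst a) \<in> carrier G" "eval_word G g w \<in> carrier G" "eval_letter G g a \<in> carrier G"
      using Cons.prems g \<phi>.G.eval_word_closed[OF g, of w] \<phi>.G.eval_letter_closed[OF g, of a] by auto
    then show ?case using Cons by (simp add: eval_word_def eval_letter_def)
  qed (simp add: eval_word_def)
qed

lemma (in group) group_hom_conjugation:
  assumes "p \<in> carrier G"
  shows "group_hom G G (\<lambda>x. p \<otimes> x \<otimes> inv p)"
proof -
  have "inv p \<otimes> (p \<otimes> y) = y" if "y \<in> carrier G" for y
    using that assms by (simp flip: m_assoc)
  then show ?thesis using assms
    by unfold_locales (auto intro!: homI simp: m_assoc)
qed

text \<open>
  Substitutions are functions on all natural numbers, so there are infinitely many of them;
  but only their restrictions to the \<open>k\<close> generators matter.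
\<close>
lemma finite_eval_kernels:
  assumes "finite (carrier G)"
  shows "finite (kernel (free_group k) G ` eval_word G ` ({..<k} \<rightarrow> carrier G))"
proof (rule finite_subset)
  show "finite (kernel (free_group k) G ` eval_word G ` ({..<k} \<rightarrow>\<^sub>E carrier G))"
    by (intro finite_imageI finite_PiE) (simp_all add: assms)
  show "kernel (free_group k) G ` eval_word G ` ({..<k} \<rightarrow> carrier G) \<subseteq>
    kernel (free_group k) G ` eval_word G ` ({..<k} \<rightarrow>\<^sub>E carrier G)"
  proof
    fix N assume "N \<in> kernel (free_group k) G ` eval_word G ` ({..<k} \<rightarrow> carrier G)"
    then obtain g where g: "g \<in> {..<k} \<rightarrow> carrier G" "N = kernel (free_group k) G (eval_word G g)"
      by blast
    have "eval_word G (restrict g {..<k}) w = eval_word G g w" if "w \<in> carrier (free_group k)" for w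
      using letters_free_group[OF that] by (intro eval_word_cong) auto
    then have "N = kernel (free_group k) G (eval_word G (restrict g {..<k}))"
      unfolding g(2) kernel_def by (metis (mono_tags, lifting))
    moreover have "restrict g {..<k} \<in> {..<k} \<rightarrow>\<^sub>E carrier G" using g(1) by auto
    ultimately show "N \<in> kernel (free_group k) G ` eval_word G ` ({..<k} \<rightarrow>\<^sub>E carrier G)" by blast
  qed
qed

section \<open>Values of the separating word\<close>

text \<open>
  Since \<open>f\<close> and \<open>h\<close> have the same kernel, \<open>h u\<close> and \<open>h v\<close> have orders \<open>2\<close> and \<open>3\<close>, hence
  traces \<open>0\<close> and \<open>1\<close>, and both \<open>h w\<close> and the commutator of \<open>h u\<close> with \<open>h v\<close> have order \<open>17\<close>.
  By the trace identity, the trace of this commutator is \<open>1 + s ^ 2\<close>, where \<open>s\<close> is the trace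
  of \<open>h w\<close>. So the octic vanishes at \<open>s\<close> and at \<open>1 + s ^ 2\<close>, which singles out the roots of
  the quartic. This argument replaces a description of the automorphisms of the group.
\<close>
lemma trace_transfer:
  fixes f h :: "'w \<Rightarrow> 'a::field ^ 2 ^ 2"
  assumes two: "(2::'a) = 0" and t: "t ^ 4 + t + 1 = 0"
    and "group F" and f: "f \<in> hom F SL" and h: "h \<in> hom F SL"
    and ker: "kernel F SL h = kernel F SL f"
    and F: "u \<in> carrier F" "v \<in> carrier F" "w \<in> carrier F"
    and fu: "f u = mat2 1 (t + 1) 0 1" and fv: "f v = mat2 0 1 1 1" and fw: "f w = f u \<otimes>\<^bsub>SL\<^esub> f v"
  shows "trace (h w) ^ 4 + trace (h w) + 1 = 0"
proof -
  interpret F: group F by fact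
  interpret f: group_hom F SL f by unfold_locales (rule f)
  interpret h: group_hom F SL h by unfold_locales (rule h)
  have transfer: "f x = \<one>\<^bsub>SL\<^esub> \<longleftrightarrow> h x = \<one>\<^bsub>SL\<^esub>" if "x \<in> carrier F" for x
    using ker that unfolding kernel_def by blast
  have transfer_pow: "f x [^]\<^bsub>SL\<^esub> k = \<one>\<^bsub>SL\<^esub> \<longleftrightarrow> h x [^]\<^bsub>SL\<^esub> k = \<one>\<^bsub>SL\<^esub>" if "x \<in> carrier F" for x and k :: nat
    using transfer[of "x [^]\<^bsub>F\<^esub> k"] that by (simp add: f.hom_nat_pow h.hom_nat_pow)
  have one: "\<one>\<^bsub>SL\<^esub> = mat2 1 0 0 (1::'a)" by (simp add: SL_simps mat_1_mat2)
  have hF: "h u \<in> carrier SL" "h v \<in> carrier SL" "h w \<in> carrier SL" using F by auto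
  have fF: "f u \<in> carrier SL" "f v \<in> carrier SL" "f w \<in> carrier SL" using F by auto
  have "f u [^]\<^bsub>SL\<^esub> (2::nat) = \<one>\<^bsub>SL\<^esub>"
    using SL2_pow(1)[OF two fF(1)] by (simp add: fu one two)
  then have tru: "trace (h u) = 0"
    using trace_involution[OF two hF(1)] transfer_pow[OF F(1)] by blast
  have "f v [^]\<^bsub>SL\<^esub> (3::nat) = \<one>\<^bsub>SL\<^esub>" "f v \<noteq> \<one>\<^bsub>SL\<^esub>"
    using SL2_pow(2)[OF two fF(2)] by (simp_all add: fv one two)
  then have trv: "trace (h v) = 1"
    using trace_order_3[OF two hF(2)] transfer_pow[OF F(2)] transfer[OF F(2)] by blast
  have hw: "h w = h u \<otimes>\<^bsub>SL\<^esub> h v"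
  proof -
    have "f (w \<otimes>\<^bsub>F\<^esub> inv\<^bsub>F\<^esub> (u \<otimes>\<^bsub>F\<^esub> v)) = \<one>\<^bsub>SL\<^esub>" using F fw by simp
    moreover have "w \<otimes>\<^bsub>F\<^esub> inv\<^bsub>F\<^esub> (u \<otimes>\<^bsub>F\<^esub> v) \<in> carrier F" using F by simp
    ultimately have "h (w \<otimes>\<^bsub>F\<^esub> inv\<^bsub>F\<^esub> (u \<otimes>\<^bsub>F\<^esub> v)) = \<one>\<^bsub>SL\<^esub>" using transfer by blast
    then have "h w \<otimes>\<^bsub>SL\<^esub> inv\<^bsub>SL\<^esub> (h u \<otimes>\<^bsub>SL\<^esub> h v) = \<one>\<^bsub>SL\<^esub>" using F by simp
    then show ?thesis using F by (simp add: SL.inv_solve_right')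
  qed
  have order_17: "trace (h x) ^ 8 + trace (h x) ^ 7 + trace (h x) ^ 6 + trace (h x) ^ 4 + 1 = 0"
    if x: "x \<in> carrier F" and root: "trace (f x) ^ 4 + trace (f x) + 1 = 0" for x
  proof -
    have fx: "f x \<in> carrier SL" "h x \<in> carrier SL" using x by auto
    have ord: "SL.ord (f x) = 17" by (rule order_17_trace[OF two fx(1) root])
    then have "f x [^]\<^bsub>SL\<^esub> (17::nat) = \<one>\<^bsub>SL\<^esub>" using SL.pow_ord_eq_1[OF fx(1)] by simp
    moreover have "f x \<noteq> \<one>\<^bsub>SL\<^esub>" using ord SL.ord_eq_1[OF fx(1)] by auto
    ultimately show ?thesis
      using trace_order_17[OF two fx(2)] transfer_pow[OF x] transfer[OF x] by blast
  qed
  have trw: "trace (f w) = t" unfolding fw fu fv by (simp add: SL_simps add.assoc two)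
  define c where "c = u \<otimes>\<^bsub>F\<^esub> v \<otimes>\<^bsub>F\<^esub> inv\<^bsub>F\<^esub> u \<otimes>\<^bsub>F\<^esub> inv\<^bsub>F\<^esub> v"
  have cF: "c \<in> carrier F" using F by (simp add: c_def)
  have trc: "trace (f c) = t\<^sup>2 + 1"
    using F trw[unfolded fw] fF trace_commutator_mat2[OF fF(1,2)]
    by (simp add: c_def) (simp add: fu fv two char2_numeral[OF two])
  have "(t\<^sup>2 + 1) ^ 4 + (t\<^sup>2 + 1) + 1 = 0"
  proof -
    have "t\<^sup>2 + 1 \<in> {s. s ^ 4 + s + 1 = 0}" unfolding char2_quartic_roots(1)[OF two t] by simp
    then show ?thesis by (rule CollectD)
  qed
  then have "trace (h c) ^ 8 + trace (h c) ^ 7 + trace (h c) ^ 6 + trace (h c) ^ 4 + 1 = 0"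
    using order_17[OF cF] unfolding trc by blast
  moreover have "trace (h c) = 1 + (trace (h w))\<^sup>2"
    using F trace_commutator_mat2[OF hF(1,2)] by (simp add: c_def tru trv hw two)
  ultimately show ?thesis
    using char2_root_of_pair[OF two order_17[OF F(3)]] trw t by simp
qed

theorem theorem1p1:
  fixes n :: nat
    and G :: "('a::{field, finite} ^ 2 ^ 2) monoid"
  assumes "n \<ge> 2"
    and "CARD('a) = 2 ^ (2 ^ n)"
    and "G = SL"
  shows "\<exists>w \<in> carrier (free_group 2).
           \<one>\<^bsub>G\<^esub> \<in> word_values G 2 w \<and>
           card {C \<in> conjugacy_classes G. (\<forall>x \<in> C. group.ord G x = 17) \<and> C \<subseteq> word_values G 2 w} = 4"
proof -
  have two: "(2::'a) = 0" by (rule two_eq_zero_if_card_power_of_two[OF assms(2)])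
  obtain t :: 'a where t: "t ^ 4 + t + 1 = 0" using quartic_has_root[OF assms(2,1)] by blast
  note t01 = char2_quartic_root_facts(3,4)[OF two t]
  obtain l :: 'a where l: "l \<noteq> 0" and gen: "\<And>x. x \<noteq> 0 \<Longrightarrow> \<exists>i::nat. x = l ^ i"
    by (rule finite_field_primitive_element) blast
  have l1: "l \<noteq> 1" using gen[OF t01(1)] t01(2) by auto
  \<comment> \<open>evaluation at Steinberg's generators is a surjection from the free group\<close>
  let ?F = "free_group 2" and ?E = "{..<2::nat} \<rightarrow> carrier (SL :: ('a ^ 2 ^ 2) monoid)"
  define A :: "'a ^ 2 ^ 2" where "A = mat2 l 0 0 (1 / l)"
  define B :: "'a ^ 2 ^ 2" where "B = mat2 1 1 1 0"
  define g0 where "g0 i = (if i = 0 then A else B)" for i :: nat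
  define f where "f = eval_word SL g0"
  interpret F: group ?F by (rule group_free_group)
  have AB: "A \<in> carrier SL" "B \<in> carrier SL"
    using l by (simp_all add: A_def B_def SL_simps char2_uminus[OF two])
  then have g0: "g0 \<in> ?E" by (simp add: g0_def)
  have f: "f \<in> hom ?F SL" unfolding f_def by (rule SL.eval_word_hom[OF g0])
  interpret f: group_hom ?F SL f by unfold_locales (rule f)
  have gens: "[(i, True)] \<in> carrier ?F" if "i < 2" for i
    using that by (simp add: free_group_def reduced_def)
  have surj: "f ` carrier ?F = carrier SL"
  proof (rule steinberg_generators[OF two l l1 gen])
    show "subgroup (f ` carrier ?F) SL" by (rule f.img_is_subgroup)
    have "A = f [(0, True)]" "B = f [(1, True)]"
      using AB by (simp_all add: f_def SL.eval_word_generator g0_def)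
    then show "mat2 l 0 0 (1 / l) \<in> f ` carrier ?F" "mat2 1 1 1 0 \<in> f ` carrier ?F"
      unfolding A_def[symmetric] B_def[symmetric]
      by (simp_all only: imageI gens zero_less_numeral one_less_numeral_iff semiring_norm)
  qed
  \<comment> \<open>\<open>X\<close> is an involution, \<open>Y\<close> has order \<open>3\<close>, and the trace of their product is \<open>t\<close>\<close>
  define X :: "'a ^ 2 ^ 2" where "X = mat2 1 (t + 1) 0 1"
  define Y :: "'a ^ 2 ^ 2" where "Y = mat2 0 1 1 1"
  have "t + 1 \<noteq> 0" using t01 by (simp add: char2_eq_iff[OF two])
  then have XY: "X \<in> carrier SL" "Y \<in> carrier SL" "X \<otimes>\<^bsub>SL\<^esub> Y \<noteq> Y \<otimes>\<^bsub>SL\<^esub> X"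
    by (simp_all add: X_def Y_def SL_simps char2_uminus[OF two])
  obtain u where u: "u \<in> carrier ?F" "f u = X" using XY(1) unfolding surj[symmetric] by blast
  obtain v where v: "v \<in> carrier ?F" "f v = Y" using XY(2) unfolding surj[symmetric] by blast
  have "\<exists>w\<in>carrier ?F. f w = X \<otimes>\<^bsub>SL\<^esub> Y \<and>
      (\<forall>h\<in>eval_word SL ` ?E. h w = \<one>\<^bsub>SL\<^esub> \<or> kernel ?F SL h = kernel ?F SL f)"
    by (rule separating_element[OF F.is_group simple_SL2[OF two t01] XY finite f surj])
      (use SL.eval_word_hom XY in \<open>auto intro!: finite_eval_kernels\<close>)
  then obtain w where w: "w \<in> carrier ?F" "f w = X \<otimes>\<^bsub>SL\<^esub> Y"
    and sep: "\<And>g. g \<in> ?E \<Longrightarrow> eval_word SL g w = \<one>\<^bsub>SL\<^esub> \<or> kernel ?F SL (eval_word SL g) = kernel ?F SL f"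
    by blast
  note letters = letters_free_group[OF w(1)]
  define R where "R = {s::'a. s ^ 4 + s + 1 = 0}"
  define V :: "('a ^ 2 ^ 2) set" where "V = word_values SL2 2 w"
  have val: "eval_word SL g w = \<one>\<^bsub>SL\<^esub> \<or> trace (eval_word SL g w) \<in> R" if g: "g \<in> ?E" for g
    using sep[OF g] trace_transfer[OF two t F.is_group f SL.eval_word_hom[OF g] _ u(1) v(1) w(1)]
      u(2) v(2) w(2) by (auto simp: R_def X_def Y_def)
  have V: "M = \<one>\<^bsub>SL\<^esub> \<or> trace M \<in> R" if M: "M \<in> V" for M :: "'a ^ 2 ^ 2"
  proof -
    obtain g where g: "g \<in> ?E" "M \<in> {eval_word SL g w, inv\<^bsub>SL\<^esub> eval_word SL g w}"
      using M unfolding V_def word_values_def by (rule UN_E)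
    then show ?thesis
      using val[OF g(1)] SL.eval_word_closed[OF g(1) letters] by (auto simp: trace_inv_SL2)
  qed
  have one: "\<one>\<^bsub>SL\<^esub> \<in> V"
  proof -
    have "eval_word SL (\<lambda>i. \<one>\<^bsub>SL\<^esub>) w = (\<one>\<^bsub>SL\<^esub> :: 'a ^ 2 ^ 2)"
      by (rule eval_word_one) (rule group_SL)
    then have "\<one>\<^bsub>SL\<^esub> \<in> {eval_word SL (\<lambda>i. \<one>\<^bsub>SL\<^esub>) w, inv\<^bsub>SL\<^esub> eval_word SL (\<lambda>i. \<one>\<^bsub>SL2\<^esub> :: 'a ^ 2 ^ 2) w}" by simp
    moreover have "(\<lambda>i. \<one>\<^bsub>SL\<^esub>) \<in> ?E" by simp
    ultimately show ?thesis unfolding V_def word_values_def by (rule UN_I[rotated])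
  qed
  \<comment> \<open>the traces of the values form a set invariant under the Frobenius map, which permutes the roots cyclically\<close>
  define T :: "'a set" where "T = {trace (eval_word SL g w) | g. g \<in> ?E}"
  have square: "s\<^sup>2 \<in> T" if s: "s \<in> T" for s
  proof -
    obtain g where g: "g \<in> ?E" "s = trace (eval_word SL g w)" using s unfolding T_def by blast
    interpret fr: group_hom SL2 SL2 "frobenius :: 'a ^ 2 ^ 2 \<Rightarrow> _" by (rule group_hom_frobenius[OF two])
    have "trace (eval_word SL (frobenius \<circ> g) w) = s\<^sup>2"
      by (simp only: eval_word_image[OF fr.group_hom_axioms g(1) letters] trace_frobenius[OF two] g(2))
    moreover have "(frobenius \<circ> g) i \<in> carrier SL" if "i \<in> {..<2}" for i
      by (simp add: Pi_mem[OF g(1) that])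
    then have "frobenius \<circ> g \<in> ?E" by (rule Pi_I)
    ultimately show ?thesis
      unfolding T_def by (intro CollectI exI[of _ "frobenius \<circ> g"] conjI) (rule sym)
  qed
  have "trace (f w) = t" unfolding w(2) by (simp add: X_def Y_def SL_simps add.assoc two)
  then have trw: "trace (eval_word SL g0 w) = t" by (simp only: f_def)
  have "trace (eval_word SL g0 w) \<in> T" unfolding T_def using g0 by blast
  then have tT: "t \<in> T" unfolding trw .
  have RT: "R \<subseteq> T" unfolding R_def by (rule char2_quartic_roots_subset[OF two t tT square])
  have nontriv: "M \<noteq> \<one>\<^bsub>SL\<^esub>" if "trace M \<in> R" for M :: "'a ^ 2 ^ 2"
    using that by (auto simp: R_def SL_simps mat_1_mat2 two)
  define cl where "cl s = {M \<in> carrier SL2. trace M = s}" for s :: 'a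
  \<comment> \<open>the classes with a root as trace are the fibres of the trace, as \<open>1\<close> does not lie in them\<close>
  have orbit: "orbit SL (\<lambda>g. \<lambda>h\<in>carrier SL2. g \<otimes>\<^bsub>SL\<^esub> h \<otimes>\<^bsub>SL\<^esub> inv\<^bsub>SL\<^esub> g) M = cl (trace M)"
    if M: "M \<in> carrier SL" "trace M \<in> R" for M :: "'a ^ 2 ^ 2"
  proof (intro equalityI subsetI)
    fix N assume "N \<in> orbit SL (\<lambda>g. \<lambda>h\<in>carrier SL2. g \<otimes>\<^bsub>SL\<^esub> h \<otimes>\<^bsub>SL\<^esub> inv\<^bsub>SL\<^esub> g) M"
    then show "N \<in> cl (trace M)" using M by (auto simp: orbit_def cl_def trace_conjugate_SL2)
  next
    fix N assume "N \<in> cl (trace M)"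
    then have N: "N \<in> carrier SL" "trace M = trace N" by (auto simp: cl_def)
    obtain P where "P \<in> carrier SL" "N = P \<otimes>\<^bsub>SL\<^esub> M \<otimes>\<^bsub>SL\<^esub> inv\<^bsub>SL\<^esub> P"
      using conjugate_if_trace_eq[OF two M(1) nontriv[OF M(2)] N(1) nontriv N(2)] M(2) N(2) by auto
    then show "N \<in> orbit SL (\<lambda>g. \<lambda>h\<in>carrier SL2. g \<otimes>\<^bsub>SL\<^esub> h \<otimes>\<^bsub>SL\<^esub> inv\<^bsub>SL\<^esub> g) M"
      using M(1) by (auto simp: orbit_def)
  qed
  have clV: "cl s \<subseteq> V" if s: "s \<in> R" for s
  proof
    fix N assume "N \<in> cl s"
    then have N: "N \<in> carrier SL" "trace N = s" by (auto simp: cl_def)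
    have "s \<in> T" using RT s by (rule subsetD)
    then obtain g where g: "g \<in> ?E" "s = trace (eval_word SL g w)" unfolding T_def by blast
    let ?M = "eval_word SL g w"
    have M: "?M \<in> carrier SL" by (rule SL.eval_word_closed[OF g(1) letters])
    have R: "trace ?M \<in> R" "trace N \<in> R" "trace ?M = trace N" using s N(2) g(2) by simp_all
    obtain P where P: "P \<in> carrier SL" "N = P \<otimes>\<^bsub>SL\<^esub> ?M \<otimes>\<^bsub>SL\<^esub> inv\<^bsub>SL\<^esub> P"
      using conjugate_if_trace_eq[OF two M nontriv[OF R(1)] N(1) nontriv[OF R(2)] R(3)] by (rule bexE)
    let ?c = "\<lambda>x. P \<otimes>\<^bsub>SL\<^esub> x \<otimes>\<^bsub>SL\<^esub> inv\<^bsub>SL\<^esub> P"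
    have "N = eval_word SL (?c \<circ> g) w"
      unfolding eval_word_image[OF SL.group_hom_conjugation[OF P(1)] g(1) letters] by (rule P(2))
    moreover have "?c \<circ> g \<in> ?E"
      by (rule Pi_I) (simp add: Pi_mem[OF g(1)] P(1))
    ultimately show "N \<in> V"
      unfolding V_def word_values_def by (intro UN_I[of "?c \<circ> g"]) simp_all
  qed
  let ?C = "\<lambda>s::'a. mat2 0 1 1 s"
  have C: "?C s \<in> cl s" for s by (simp add: cl_def SL_simps char2_uminus[OF two])
  have "{C \<in> conjugacy_classes SL2. (\<forall>x\<in>C. SL.ord x = 17) \<and> C \<subseteq> V} = cl ` R"
  proof (intro equalityI subsetI)
    fix D assume "D \<in> {C \<in> conjugacy_classes SL2. (\<forall>x\<in>C. SL.ord x = 17) \<and> C \<subseteq> V}"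
    then obtain M where M: "M \<in> carrier SL" and
      D: "D = orbit SL (\<lambda>g. \<lambda>h\<in>carrier SL2. g \<otimes>\<^bsub>SL\<^esub> h \<otimes>\<^bsub>SL\<^esub> inv\<^bsub>SL\<^esub> g) M" "\<forall>x\<in>D. SL.ord x = 17" "D \<subseteq> V"
      by (auto simp: conjugacy_classes_def orbits_def)
    have "M \<in> D" unfolding D(1) orbit_def using M by (auto intro!: exI[of _ "\<one>\<^bsub>SL\<^esub>"])
    then have "SL.ord M = 17" "M \<in> V" using D by auto
    then have "trace M \<in> R" using V SL.ord_eq_1[OF M] by fastforce
    then show "D \<in> cl ` R" using orbit[OF M] D(1) by auto
  next
    fix D assume "D \<in> cl ` R"
    then obtain s where s: "s \<in> R" "D = cl s" by blast
    have "?C s \<in> carrier SL" "trace (?C s) = s" using C[of s] by (auto simp: cl_def)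
    then have "D \<in> conjugacy_classes SL"
      using orbit[of "?C s"] s unfolding conjugacy_classes_def orbits_def by force
    moreover have "SL.ord x = 17" if "x \<in> D" for x
      using that s order_17_trace[OF two, of x] by (auto simp: cl_def R_def)
    ultimately show "D \<in> {C \<in> conjugacy_classes SL2. (\<forall>x\<in>C. SL.ord x = 17) \<and> C \<subseteq> V}"
      using clV[OF s(1)] s(2) by blast
  qed
  moreover have "inj_on cl R"
  proof (rule inj_onI)
    fix r s assume "cl r = cl s"
    then have "?C r \<in> cl s" using C[of r] by simp
    then show "r = s" by (simp add: cl_def)
  qed
  ultimately have "card {C \<in> conjugacy_classes SL2. (\<forall>x\<in>C. SL.ord x = 17) \<and> C \<subseteq> V} = 4"
    using char2_quartic_roots(2)[OF two t] by (simp add: card_image R_def)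
  then show ?thesis using w(1) one unfolding V_def assms(3) by blast
qed

end
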